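(* Let $\epsilon>0$ and let $f:\mathbb{R}\to\mathbb{R}$ be convex and $M$-quasi-self-concordant, in the setting described in the context. There is a choice of parameters $\tau=\tilde\Theta\left(m^{1/3}\epsilon^{-2/3}\right)$ and $\alpha=\tilde\Theta\left(m^{-1/3}M^{-1}\epsilon^{2/3}\right)$ such that, after $T\le\frac{1}{\alpha M\epsilon}=\tilde\Theta\left(m^{1/3}\epsilon^{-5/3}\right)$ flow steps and $K\le\tau=\tilde\Theta\left(m^{1/3}\epsilon^{-2/3}\right)$ width reduction steps, the algorithm QSC-MWU returns $\tilde x$ such that $A\tilde x=b$ and $$\|P\tilde x\|_\infty\le RM\,\|w^{(T,K)}\|_\infty,$$ where $w^{(T,K)}$ is the final weights vector, which satisfies $$\Phi(w^{(T,K)})\le\Phi(w_0)\,e^{1+4\epsilon}\quad\text{if } f'' \text{ is non-decreasing},$$ $$\Phi(w^{(T,K)})\ge\Phi(w_0)\,e^{-(1+4\epsilon)}\quad\text{if } f'' \text{ is non-increasing}$$ (monotonicity being understood on the range of weights $w\ge w_0$).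
   Context: Setting. $A\in\mathbb{R}^{d\times n}$, $b\in\mathbb{R}^d$, $P\in\mathbb{R}^{m\times n}$ with $d\le n\le m$. The function $f:\mathbb{R}\to\mathbb{R}$ is convex, with continuous third derivative, and $M$-quasi-self-concordant: $|f'''(u)|\le Mf''(u)$ for all $u$, with $M>0$. The vector $w_0\in\mathbb{R}^m_{\ge0}$ is such that $f''$ is monotone (non-decreasing or non-increasing) on the range $w\ge w_0$ of the weights, and $\Phi(w_0)>0$. $x^\star$ is a minimizer of $\sum_{i=1}^m f((Px)_i)$ subject to $Ax=b$, and $R>0$ satisfies $\|Px^\star\|_\infty\le R$. Potentials. For $w\in\mathbb{R}^m_{\ge0}$, $\Phi(w)=\sum_{i=1}^m f''(w_i)$. The resistances associated with $w$ are $r_i=\frac1{R^2}\left(f''(w_i)+\frac{\epsilon\Phi(w)}{m}\right)$. Algorithm QSC-MWU (parameters $\tau,\alpha>0$ and $T=\frac{1}{\alpha M\epsilon}$). Start with $x^{(0,0)}=0$, $w^{(0,0)}=w_0$, $t=k=0$. Until $T$ flow steps have been performed, repeat: let $r^{(t,k)}$ be the resistances associated with $w^{(t,k)}$ and $\tilde\Delta\in\arg\min_{A\Delta=b}\sum_i r^{(t,k)}_i(P\Delta)_i^2$. - If $\|P\tilde\Delta\|_\infty\le R\tau$ (flow step): set $x^{(t+1,k)}=x^{(t,k)}+\tilde\Delta$, $w^{(t+1,k)}=w^{(t,k)}+\frac{\epsilon\alpha}{R}|P\tilde\Delta|$ (coordinate-wise absolute value), and $t\leftarrow t+1$ ($k$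 unchanged). - Otherwise (width reduction step): for all indices $i$ with $|P\tilde\Delta|_i\ge R\tau$, increase the weight $w_i$ so that the new resistance satisfies $r_i^{(t,k+1)}=(1+\epsilon)r_i^{(t,k)}$ if $f''$ is non-decreasing, respectively $r_i^{(t,k+1)}=\frac1{1+\epsilon}r_i^{(t,k)}$ if $f''$ is non-increasing (it is assumed that such a weight change can be realized); the other weights and $x$ are unchanged; $k\leftarrow k+1$. Return $x^{(T,K)}/T$, where $K$ is the total number of width reduction steps. $\tilde\Theta$ hides factors polylogarithmic in $m$, $1/\epsilon$ and the other problem parameters (including $\|A\|$, $\|b\|_2$, $R$ and the smallest stretch $\inf_{Ax=b,\,x\neq 0}\|Px\|_2/\|x\|_2$). *)

theory Defs
  imports "HOL-Analysis.Analysis" "Jordan_Normal_Form.Matrix"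
begin

(* Vectors and matrices are those of Jordan_Normal_Form, so that the dimensions d, n, m are
   natural numbers that can be quantified: the constants hidden by the soft-Theta notation must
   not depend on them. *)
no_notation vec_nth (infixl \<open>$\<close> 90)

section \<open>Norms\<close>

definition l2_norm :: "real vec \<Rightarrow> real" where
  "l2_norm v = L2_set (\<lambda>i. v $ i) {..<dim_vec v}"

(* The extra element 0 only fixes the value for the empty vector. *)
definition linf_norm :: "real vec \<Rightarrow> real" where
  "linf_norm v = Max (insert 0 ((\<lambda>i. \<bar>v $ i\<bar>) ` {..<dim_vec v}))"

definition abs_vec :: "real vec \<Rightarrow> real vec" where
  "abs_vec v = map_vec abs v"

definition op_norm :: "real mat \<Rightarrow> real" where
  "op_norm A = Sup {l2_norm (A *\<^sub>v x) | x. x \<in> carrier_vec (dim_col A) \<and> l2_norm x \<le> 1}"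

section \<open>Assumptions on the function\<close>

abbreviation d2 :: "(real \<Rightarrow> real) \<Rightarrow> real \<Rightarrow> real" where
  "d2 f \<equiv> (deriv ^^ 2) f"

abbreviation d3 :: "(real \<Rightarrow> real) \<Rightarrow> real \<Rightarrow> real" where
  "d3 f \<equiv> (deriv ^^ 3) f"

(* deriv is a total operator, so the existence of the derivatives has to be required. *)
definition C3 :: "(real \<Rightarrow> real) \<Rightarrow> bool" where
  "C3 f \<longleftrightarrow> (\<forall>k<3. \<forall>u. (deriv ^^ k) f field_differentiable at u) \<and> continuous_on UNIV (d3 f)"

definition quasi_self_concordant :: "real \<Rightarrow> (real \<Rightarrow> real) \<Rightarrow> bool" where
  "quasi_self_concordant M f \<longleftrightarrow> (\<forall>u. \<bar>d3 f u\<bar> \<le> M * d2 f u)"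

(* Coordinate i of a weight vector w \<ge> w0 ranges over {w0 $ i..}. *)
definition nondecr_beyond :: "real vec \<Rightarrow> (real \<Rightarrow> real) \<Rightarrow> bool" where
  "nondecr_beyond w0 g \<longleftrightarrow> (\<forall>i<dim_vec w0. mono_on {w0 $ i..} g)"

definition nonincr_beyond :: "real vec \<Rightarrow> (real \<Rightarrow> real) \<Rightarrow> bool" where
  "nonincr_beyond w0 g \<longleftrightarrow> (\<forall>i<dim_vec w0. antimono_on {w0 $ i..} g)"

section \<open>Problem and potentials\<close>

definition feasible :: "real mat \<Rightarrow> real vec \<Rightarrow> real vec \<Rightarrow> bool" where
  "feasible A b x \<longleftrightarrow> x \<in> carrier_vec (dim_col A) \<and> A *\<^sub>v x = b"

definition potential :: "(real \<Rightarrow> real) \<Rightarrow> real vec \<Rightarrow> real" where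
  "potential f w = (\<Sum>i<dim_vec w. d2 f (w $ i))"

definition resistance :: "(real \<Rightarrow> real) \<Rightarrow> real \<Rightarrow> real \<Rightarrow> real vec \<Rightarrow> real vec" where
  "resistance f R \<epsilon> w =
     vec (dim_vec w) (\<lambda>i. 1 / R\<^sup>2 * (d2 f (w $ i) + \<epsilon> * potential f w / real (dim_vec w)))"

definition energy :: "real mat \<Rightarrow> real vec \<Rightarrow> real vec \<Rightarrow> real" where
  "energy P r \<Delta> = (\<Sum>i<dim_row P. r $ i * ((P *\<^sub>v \<Delta>) $ i)\<^sup>2)"

definition qsc_setting ::
  "nat \<Rightarrow> nat \<Rightarrow> nat \<Rightarrow> real mat \<Rightarrow> real vec \<Rightarrow> real mat \<Rightarrow> (real \<Rightarrow> real) \<Rightarrow> real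
    \<Rightarrow> real vec \<Rightarrow> real vec \<Rightarrow> real \<Rightarrow> bool" where
  "qsc_setting d n m A b P f M w0 xstar R \<longleftrightarrow>
     d \<le> n \<and> n \<le> m \<and>
     A \<in> carrier_mat d n \<and> b \<in> carrier_vec d \<and> P \<in> carrier_mat m n \<and>
     convex_on UNIV f \<and> C3 f \<and> 0 < M \<and> quasi_self_concordant M f \<and>
     w0 \<in> carrier_vec m \<and> (\<forall>i<m. 0 \<le> w0 $ i) \<and>
     (nondecr_beyond w0 (d2 f) \<or> nonincr_beyond w0 (d2 f)) \<and>
     0 < potential f w0 \<and>
     is_arg_min (\<lambda>x. \<Sum>i<m. f ((P *\<^sub>v x) $ i)) (feasible A b) xstar \<and>
     0 < R \<and> linf_norm (P *\<^sub>v xstar) \<le> R"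

section \<open>The algorithm\<close>

(* The new resistances depend on all the new weights through the potential, so the equations
   for the coordinates in H form a system for w'. *)
definition width_change ::
  "(real \<Rightarrow> real) \<Rightarrow> real vec \<Rightarrow> real \<Rightarrow> real \<Rightarrow> nat set \<Rightarrow> real vec \<Rightarrow> real vec \<Rightarrow> bool" where
  "width_change f w0 R \<epsilon> H w w' \<longleftrightarrow>
     dim_vec w' = dim_vec w \<and>
     (\<forall>i<dim_vec w. i \<notin> H \<longrightarrow> w' $ i = w $ i) \<and>
     (\<forall>i\<in>H. w $ i \<le> w' $ i) \<and>
     (nondecr_beyond w0 (d2 f) \<and>
        (\<forall>i\<in>H. resistance f R \<epsilon> w' $ i = (1 + \<epsilon>) * resistance f R \<epsilon> w $ i) \<or>
      nonincr_beyond w0 (d2 f) \<and>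
        (\<forall>i\<in>H. resistance f R \<epsilon> w' $ i = 1 / (1 + \<epsilon>) * resistance f R \<epsilon> w $ i))"

definition wide_coords :: "real mat \<Rightarrow> real \<Rightarrow> real \<Rightarrow> real vec \<Rightarrow> nat set" where
  "wide_coords P R \<tau> \<Delta> = {i. i < dim_row P \<and> \<bar>(P *\<^sub>v \<Delta>) $ i\<bar> \<ge> R * \<tau>}"

(* (t, k, x, w): numbers of flow and of width reduction steps done so far, iterate, weights *)
type_synonym mwu_state = "nat \<times> nat \<times> real vec \<times> real vec"

(* A relation, because neither the minimizer nor the change of weights is unique. *)
inductive mwu_step ::
  "real mat \<Rightarrow> real vec \<Rightarrow> real mat \<Rightarrow> (real \<Rightarrow> real) \<Rightarrow> real vec \<Rightarrow> real \<Rightarrow> real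
    \<Rightarrow> real \<Rightarrow> real \<Rightarrow> nat \<Rightarrow> mwu_state \<Rightarrow> mwu_state \<Rightarrow> bool"
  for A b P f w0 R \<epsilon> \<tau> \<alpha> T where
  flow:
    "\<lbrakk>t < T; is_arg_min (energy P (resistance f R \<epsilon> w)) (feasible A b) \<Delta>;
      linf_norm (P *\<^sub>v \<Delta>) \<le> R * \<tau>\<rbrakk>
     \<Longrightarrow> mwu_step A b P f w0 R \<epsilon> \<tau> \<alpha> T (t, k, x, w)
           (Suc t, k, x + \<Delta>, w + (\<epsilon> * \<alpha> / R) \<cdot>\<^sub>v abs_vec (P *\<^sub>v \<Delta>))"
| width_reduction:
    "\<lbrakk>t < T; is_arg_min (energy P (resistance f R \<epsilon> w)) (feasible A b) \<Delta>;
      \<not> linf_norm (P *\<^sub>v \<Delta>) \<le> R * \<tau>;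
      width_change f w0 R \<epsilon> (wide_coords P R \<tau> \<Delta>) w w'\<rbrakk>
     \<Longrightarrow> mwu_step A b P f w0 R \<epsilon> \<tau> \<alpha> T (t, k, x, w) (t, Suc k, x, w')"

definition mwu_reachable ::
  "real mat \<Rightarrow> real vec \<Rightarrow> real mat \<Rightarrow> (real \<Rightarrow> real) \<Rightarrow> real vec \<Rightarrow> real \<Rightarrow> real
    \<Rightarrow> real \<Rightarrow> real \<Rightarrow> nat \<Rightarrow> mwu_state \<Rightarrow> bool" where
  "mwu_reachable A b P f w0 R \<epsilon> \<tau> \<alpha> T s \<longleftrightarrow>
     (mwu_step A b P f w0 R \<epsilon> \<tau> \<alpha> T)\<^sup>*\<^sup>* (0, 0, 0\<^sub>v (dim_col A), w0) s"

definition width_changes_realizable ::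
  "real mat \<Rightarrow> real vec \<Rightarrow> real mat \<Rightarrow> (real \<Rightarrow> real) \<Rightarrow> real vec \<Rightarrow> real \<Rightarrow> real
    \<Rightarrow> real \<Rightarrow> real \<Rightarrow> nat \<Rightarrow> bool" where
  "width_changes_realizable A b P f w0 R \<epsilon> \<tau> \<alpha> T \<longleftrightarrow>
     (\<forall>t k x w \<Delta>. mwu_reachable A b P f w0 R \<epsilon> \<tau> \<alpha> T (t, k, x, w) \<and> t < T \<and>
        is_arg_min (energy P (resistance f R \<epsilon> w)) (feasible A b) \<Delta> \<and>
        \<not> linf_norm (P *\<^sub>v \<Delta>) \<le> R * \<tau>
        \<longrightarrow> (\<exists>w'. width_change f w0 R \<epsilon> (wide_coords P R \<tau> \<Delta>) w w'))"

section \<open>Soft-Theta\<close>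

definition smallest_stretch :: "real mat \<Rightarrow> real vec \<Rightarrow> real mat \<Rightarrow> real" where
  "smallest_stretch A b P =
     Inf {l2_norm (P *\<^sub>v x) / l2_norm x | x. feasible A b x \<and> x \<noteq> 0\<^sub>v (dim_col A)}"

(* Absolute values, since a parameter may be large or small; polylogarithmic means bounded by
   a constant times a power of this quantity, which is at least 1. *)
definition log_size :: "nat \<Rightarrow> real \<Rightarrow> real mat \<Rightarrow> real vec \<Rightarrow> real mat \<Rightarrow> real \<Rightarrow> real" where
  "log_size m \<epsilon> A b P R =
     1 + \<bar>ln (real m)\<bar> + \<bar>ln (1 / \<epsilon>)\<bar> + \<bar>ln (op_norm A)\<bar> + \<bar>ln (l2_norm b)\<bar> + \<bar>ln R\<bar>
       + \<bar>ln (smallest_stretch A b P)\<bar>"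

definition soft_theta :: "real \<Rightarrow> nat \<Rightarrow> real \<Rightarrow> real \<Rightarrow> real \<Rightarrow> bool" where
  "soft_theta C p L g v \<longleftrightarrow> g / (C * L ^ p) \<le> v \<and> v \<le> C * L ^ p * g"

end

(* Besides the potential Phi, follow the least energy E of a feasible vector with respect to the
   current resistances.  Always E <= (1 + eps) Phi, since xstar has |P xstar| <= R.

   Flow steps change log Phi by at most (1 + 3 eps) / T, by AM-GM and the exponential growth bound
   that quasi-self-concordance gives for f''.  A width reduction step changes it by at most
   eps / tau, because the coordinates of size at least R tau carry little resistance.

   Conversely one wide coordinate already carries a share eps tau^2 / ((1 + eps) m) of the energy,
   so a width reduction step multiplies E by a factor at least exp (2 Lambda / tau) (respectively
   divides it), where Lambda exceeds the logarithm of the a priori ratio Q between (1 + eps) Phi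
   and the lower bound eps Phi mu / (m R^2) of E; mu is the least value of |P y|_2^2 on Ay = b.
   Comparing the two rates bounds the number of width reductions by tau.  The logarithm of Q is
   controlled by the smallest stretch, since |P y| >= stretch |y| >= stretch |b| / |A|. *)

theory Submission
  imports Defs
begin

section \<open>Norms and least squares\<close>

text \<open>The exponents of \<tau> come from one inequality. Rescaling the wide resistances changes
  the energy by a relative amount of order \<epsilon> times the share \<epsilon> \<tau>^2 / m, and
  this has to reach the rate 2 \<Lambda> / \<tau>; hence \<tau>^3 is at least of order \<Lambda> m /
  \<epsilon>^2. The rate carries a factor 2 because width reductions also move the potential: one
  \<Lambda> / \<tau> per step pays for that, the other one bounds the number of steps.

  Two degenerate situations shape the argument. P may have a nontrivial kernel, so minimizers need
  not be unique and sublevel sets of the energy need not be compact; existence is obtained by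
  projecting in the image of P, and every estimate holds for an arbitrary minimizer. And \<mu> may
  vanish, which makes the ratio Q meaningless; then every minimizer that is met satisfies P \<Delta>
  = 0, and no width reduction occurs.

  T is an integer, so it is fixed before \<alpha>, by rounding up, and \<alpha> is solved from
  \<alpha> M \<epsilon> T = 1.\<close>

lemma linf_norm_ge: "i < dim_vec v \<Longrightarrow> \<bar>v $ i\<bar> \<le> linf_norm v"
  unfolding linf_norm_def by (intro Max_ge) auto

lemma linf_norm_le: "0 \<le> c \<Longrightarrow> (\<And>i. i < dim_vec v \<Longrightarrow> \<bar>v $ i\<bar> \<le> c) \<Longrightarrow> linf_norm v \<le> c"
  unfolding linf_norm_def by (subst Max_le_iff) auto

lemma linf_norm_gt_obtains:
  assumes "\<not> linf_norm v \<le> c" "0 \<le> c"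
  obtains i where "i < dim_vec v" "c < \<bar>v $ i\<bar>"
  using linf_norm_le[of c v] assms by fastforce

lemma power2_l2_norm: "(l2_norm v)\<^sup>2 = (\<Sum>i<dim_vec v. (v $ i)\<^sup>2)"
  unfolding l2_norm_def L2_set_def by (simp add: sum_nonneg)

lemma l2_norm_nonneg: "0 \<le> l2_norm v"
  unfolding l2_norm_def by (rule L2_set_nonneg)

lemma l2_norm_smult: "l2_norm (c \<cdot>\<^sub>v v) = \<bar>c\<bar> * l2_norm v"
proof -
  have "(\<Sum>i<dim_vec v. ((c \<cdot>\<^sub>v v) $ i)\<^sup>2) = c\<^sup>2 * (\<Sum>i<dim_vec v. (v $ i)\<^sup>2)"
    by (auto simp: sum_distrib_left power_mult_distrib intro!: sum.cong)
  then show ?thesis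
    by (simp add: l2_norm_def L2_set_def real_sqrt_mult)
qed

lemma l2_norm_eq_0_iff: "l2_norm v = 0 \<longleftrightarrow> v = 0\<^sub>v (dim_vec v)"
  unfolding l2_norm_def L2_set_eq_0_iff[OF finite_lessThan]
  by (metis eq_vecI index_zero_vec(1) index_zero_vec(2) lessThan_iff)

text \<open>\<open>Sup\<close> of an unbounded set of reals is unspecified, so
  \<open>op_norm\<close> carries no information before this. A crude bound is enough: the
  coordinates of a vector of the unit ball are at most 1 in absolute value.\<close>

lemma bdd_above_op_norm_set:
  "bdd_above {l2_norm (A *\<^sub>v x) | x. x \<in> carrier_vec (dim_col A) \<and> l2_norm x \<le> 1}"
proof (rule bdd_aboveI, clarify)
  fix x :: "real vec"
  assume x: "x \<in> carrier_vec (dim_col A)" "l2_norm x \<le> 1"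
  have xj: "\<bar>x $ j\<bar> \<le> 1" if "j < dim_col A" for j
  proof -
    have "\<bar>x $ j\<bar> \<le> l2_norm x"
      using member_le_L2_set[of "{..<dim_vec x}" j "\<lambda>i. \<bar>x $ i\<bar>"] that x
      by (simp add: l2_norm_def L2_set_def)
    then show ?thesis using x by simp
  qed
  have "l2_norm (A *\<^sub>v x) \<le> (\<Sum>i<dim_row A. \<bar>(A *\<^sub>v x) $ i\<bar>)"
    unfolding l2_norm_def using L2_set_le_sum_abs[of "\<lambda>i. (A *\<^sub>v x) $ i" "{..<dim_row A}"]
    by (simp del: index_mult_mat_vec add: dim_mult_mat_vec)
  also have "\<dots> \<le> (\<Sum>i<dim_row A. \<Sum>j<dim_col A. \<bar>A $$ (i, j)\<bar>)"
  proof (rule sum_mono)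
    fix i assume i: "i \<in> {..<dim_row A}"
    have "\<bar>(A *\<^sub>v x) $ i\<bar> = \<bar>\<Sum>j<dim_col A. A $$ (i, j) * x $ j\<bar>"
      using i x by (simp add: scalar_prod_def atLeast0LessThan)
    also have "\<dots> \<le> (\<Sum>j<dim_col A. \<bar>A $$ (i, j) * x $ j\<bar>)" by (rule sum_abs)
    also have "\<dots> \<le> (\<Sum>j<dim_col A. \<bar>A $$ (i, j)\<bar>)"
      using xj by (intro sum_mono) (auto simp: abs_mult intro: mult_left_le)
    finally show "\<bar>(A *\<^sub>v x) $ i\<bar> \<le> (\<Sum>j<dim_col A. \<bar>A $$ (i, j)\<bar>)" .
  qed
  finally show "l2_norm (A *\<^sub>v x) \<le> (\<Sum>i<dim_row A. \<Sum>j<dim_col A. \<bar>A $$ (i, j)\<bar>)" .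
qed

lemma l2_norm_mult_mat_vec_le:
  assumes x: "x \<in> carrier_vec (dim_col A)"
  shows "l2_norm (A *\<^sub>v x) \<le> op_norm A * l2_norm x"
proof (cases "l2_norm x = 0")
  case True
  then have "x = 0\<^sub>v (dim_col A)" using x by (simp add: l2_norm_eq_0_iff)
  then have "A *\<^sub>v x = 0\<^sub>v (dim_row A)" by (auto simp: scalar_prod_def)
  then have "l2_norm (A *\<^sub>v x) = 0" by (simp add: l2_norm_eq_0_iff)
  then show ?thesis using True by simp
next
  case False
  then have pos: "0 < l2_norm x" using l2_norm_nonneg[of x] by simp
  define y where "y = (1 / l2_norm x) \<cdot>\<^sub>v x"
  have y: "y \<in> carrier_vec (dim_col A)" "l2_norm y \<le> 1"
    using x pos by (auto simp: y_def l2_norm_smult)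
  have "l2_norm (A *\<^sub>v y) \<le> op_norm A"
    unfolding op_norm_def using y by (intro cSup_upper bdd_above_op_norm_set) auto
  moreover have "A *\<^sub>v y = (1 / l2_norm x) \<cdot>\<^sub>v (A *\<^sub>v x)"
    unfolding y_def using x by (intro mult_mat_vec[of A "dim_row A" "dim_col A"]) auto
  ultimately show ?thesis using pos by (simp add: l2_norm_smult field_simps)
qed

lemma smallest_stretch_le:
  assumes "feasible A b x" "x \<noteq> 0\<^sub>v (dim_col A)"
  shows "smallest_stretch A b P \<le> l2_norm (P *\<^sub>v x) / l2_norm x"
  unfolding smallest_stretch_def
proof (rule cInf_lower)
  show "bdd_below {l2_norm (P *\<^sub>v x) / l2_norm x |x. feasible A b x \<and> x \<noteq> 0\<^sub>v (dim_col A)}"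
    by (rule bdd_belowI[of _ 0]) (auto simp: l2_norm_nonneg)
qed (use assms in auto)

(* Induction on the number of coordinates: S is the part S0 on which the last coordinate
   vanishes, plus at most one direction e orthogonal to S0. *)
lemma weighted_projection_exists:
  fixes r :: "nat \<Rightarrow> real" and S :: "(nat \<Rightarrow> real) set"
  assumes "\<And>i. i < m \<Longrightarrow> 0 < r i"
    and "(\<lambda>_. 0) \<in> S"
    and "\<And>c x y. x \<in> S \<Longrightarrow> y \<in> S \<Longrightarrow> (\<lambda>i. c * x i + y i) \<in> S"
  shows "\<exists>s\<in>S. \<forall>y\<in>S. (\<Sum>i<m. r i * (u i - s i) * y i) = 0"
  using assms
proof (induction m arbitrary: S u)
  case 0
  then show ?case by auto
next
  case (Suc m)
  note lin = Suc.prems(3)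
  define S0 where "S0 = {s \<in> S. s m = 0}"
  have S0: "(\<lambda>_. 0) \<in> S0" "\<And>c x y. x \<in> S0 \<Longrightarrow> y \<in> S0 \<Longrightarrow> (\<lambda>i. c * x i + y i) \<in> S0"
    using Suc.prems by (auto simp: S0_def)
  have proj: "\<exists>s\<in>S0. \<forall>y\<in>S0. (\<Sum>i<Suc m. r i * (v i - s i) * y i) = 0" for v
  proof -
    have "\<exists>s\<in>S0. \<forall>y\<in>S0. (\<Sum>i<m. r i * (v i - s i) * y i) = 0"
      by (rule Suc.IH[OF _ S0]) (simp_all add: Suc.prems(1))
    then obtain s where "s \<in> S0" "\<forall>y\<in>S0. (\<Sum>i<m. r i * (v i - s i) * y i) = 0"
      by blast
    then show ?thesis by (intro bexI[of _ s]) (auto simp: S0_def)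
  qed
  obtain s where s: "s \<in> S0" "\<And>y. y \<in> S0 \<Longrightarrow> (\<Sum>i<Suc m. r i * (u i - s i) * y i) = 0"
    using proj by blast
  show ?case
  proof (cases "S = S0")
    case True
    then show ?thesis using s by blast
  next
    case False
    then obtain g where g: "g \<in> S" "g m \<noteq> 0" by (auto simp: S0_def)
    obtain p where p: "p \<in> S0" "\<And>y. y \<in> S0 \<Longrightarrow> (\<Sum>i<Suc m. r i * (g i - p i) * y i) = 0"
      using proj by blast
    define e where "e = (\<lambda>i. (- 1) * p i + g i)"
    have eS: "e \<in> S" unfolding e_def using p g by (intro lin) (auto simp: S0_def)
    have em: "e m \<noteq> 0" using g p by (simp add: e_def S0_def)
    have e_orth: "(\<Sum>i<Suc m. r i * e i * y i) = 0" if "y \<in> S0" for y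
      using p(2)[OF that] by (simp add: e_def)
    have "0 < (\<Sum>i<Suc m. r i * e i * e i)"
    proof (rule sum_pos2[of _ m])
      show "0 < r m * e m * e m"
        using em Suc.prems(1)[of m] by (smt (verit) lessI mult.assoc mult_pos_pos not_real_square_gt_zero)
      show "0 \<le> r i * e i * e i" if "i \<in> {..<Suc m}" for i
        using that Suc.prems(1)[of i] by (simp add: mult.assoc)
    qed auto
    then have ee: "(\<Sum>i<Suc m. r i * e i * e i) \<noteq> 0" by simp
    define c where "c = (\<Sum>i<Suc m. r i * (u i - s i) * e i) / (\<Sum>i<Suc m. r i * e i * e i)"
    define q where "q = (\<lambda>i. c * e i + s i)"
    have qS: "q \<in> S" unfolding q_def by (rule lin[OF eS]) (use s(1) in \<open>simp add: S0_def\<close>)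
    have split: "(\<Sum>i<Suc m. r i * (u i - q i) * y i)
        = (\<Sum>i<Suc m. r i * (u i - s i) * y i) - c * (\<Sum>i<Suc m. r i * e i * y i)" for y
      by (simp add: q_def algebra_simps sum.distrib sum_subtractf sum_distrib_left)
    have "(\<Sum>i<Suc m. r i * (u i - q i) * y i) = 0" if "y \<in> S" for y
    proof -
      \<comment> \<open>The last coordinate tells which multiple of \<open>e\<close> to remove from
        \<open>y\<close> to land in \<open>S0\<close>.\<close>
      define z where "z = (\<lambda>i. (- (y m / e m)) * e i + y i)"
      have "z \<in> S" unfolding z_def by (rule lin[OF eS that])
      then have z: "z \<in> S0" using em by (simp add: S0_def z_def)
      have "(\<Sum>i<Suc m. r i * (u i - q i) * z i) = 0"
        unfolding split using s z e_orth by simp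
      moreover have "(\<Sum>i<Suc m. r i * (u i - q i) * e i) = 0"
        unfolding split using ee by (simp add: c_def)
      moreover have "(\<Sum>i<Suc m. r i * (u i - q i) * y i) =
          (\<Sum>i<Suc m. r i * (u i - q i) * z i) + y m / e m * (\<Sum>i<Suc m. r i * (u i - q i) * e i)"
        unfolding sum_distrib_left sum.distrib[symmetric] z_def
        by (intro sum.cong) (auto simp: algebra_simps)
      ultimately show ?thesis by simp
    qed
    then show ?thesis using qS by blast
  qed
qed

text \<open>Minimizing over \<open>x + ker A\<close> means projecting \<open>P x\<close> onto the
  subspace \<open>P (ker A)\<close> for the inner product weighted by \<open>r\<close>. Working with
  images under \<open>P\<close> copes with a nontrivial kernel of \<open>P\<close>.\<close>

lemma energy_argmin_exists:
  assumes x: "feasible A b x" and P: "P \<in> carrier_mat m (dim_col A)"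
    and r: "\<And>i. i < m \<Longrightarrow> 0 < r $ i"
  shows "\<exists>\<Delta>. is_arg_min (energy P r) (feasible A b) \<Delta>"
proof -
  define n where "n = dim_col A"
  have P': "P \<in> carrier_mat m n" and A: "A \<in> carrier_mat (dim_row A) n"
    and xc: "x \<in> carrier_vec n" "A *\<^sub>v x = b"
    using assms by (auto simp: n_def feasible_def)
  define Z where "Z = {z \<in> carrier_vec n. A *\<^sub>v z = 0\<^sub>v (dim_row A)}"
  \<comment> \<open>Entries of a vector beyond its dimension are unspecified; setting them to 0
    makes \<open>S\<close> closed under linear combinations as a set of functions on
    \<open>nat\<close>.\<close>
  define S where "S = (\<lambda>z i. if i < m then (P *\<^sub>v z) $ i else 0) ` Z"
  have S0: "(\<lambda>_. 0) \<in> S"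
  proof -
    have "A *\<^sub>v 0\<^sub>v n = 0\<^sub>v (dim_row A)" by (intro eq_vecI) (simp_all add: scalar_prod_def)
    then have "0\<^sub>v n \<in> Z" by (simp add: Z_def)
    moreover have "(\<lambda>_. 0) = (\<lambda>i. if i < m then (P *\<^sub>v 0\<^sub>v n) $ i else 0)"
      using P' by (intro ext) (simp add: scalar_prod_def)
    ultimately show ?thesis unfolding S_def by (rule rev_image_eqI)
  qed
  have Slin: "(\<lambda>i. c * u i + v i) \<in> S" if uv: "u \<in> S" "v \<in> S" for c u v
  proof -
    obtain y z where yz: "y \<in> carrier_vec n" "z \<in> carrier_vec n"
        "A *\<^sub>v y = 0\<^sub>v (dim_row A)" "A *\<^sub>v z = 0\<^sub>v (dim_row A)"
      and u: "u = (\<lambda>i. if i < m then (P *\<^sub>v y) $ i else 0)"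
      and v: "v = (\<lambda>i. if i < m then (P *\<^sub>v z) $ i else 0)"
      using uv by (auto simp: S_def Z_def)
    have "A *\<^sub>v (c \<cdot>\<^sub>v y + z) = c \<cdot>\<^sub>v 0\<^sub>v (dim_row A) + 0\<^sub>v (dim_row A)"
      using yz by (simp add: mult_add_distrib_mat_vec[OF A] mult_mat_vec[OF A])
    also have "\<dots> = 0\<^sub>v (dim_row A)" by (intro eq_vecI) simp_all
    finally have "c \<cdot>\<^sub>v y + z \<in> Z" using yz by (simp add: Z_def)
    then show ?thesis unfolding S_def u v
      using yz P' by (intro image_eqI[of _ _ "c \<cdot>\<^sub>v y + z"] ext)
        (simp_all add: mult_add_distrib_mat_vec[OF P'] mult_mat_vec[OF P'])
  qed
  obtain s where s: "s \<in> S" "\<And>y. y \<in> S \<Longrightarrow> (\<Sum>i<m. r $ i * ((P *\<^sub>v x) $ i - s i) * y i) = 0"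
    using weighted_projection_exists[of m "\<lambda>i. r $ i" S "\<lambda>i. (P *\<^sub>v x) $ i"] r S0 Slin by blast
  obtain z where z: "z \<in> carrier_vec n" "A *\<^sub>v z = 0\<^sub>v (dim_row A)"
    and sz: "s = (\<lambda>i. if i < m then (P *\<^sub>v z) $ i else 0)"
    using s(1) by (auto simp: S_def Z_def)
  define \<Delta> where "\<Delta> = x - z"
  have \<Delta>c: "\<Delta> \<in> carrier_vec n" using xc z by (simp add: \<Delta>_def)
  have "A *\<^sub>v \<Delta> = b - 0\<^sub>v (dim_row A)"
    unfolding \<Delta>_def using xc z by (simp add: mult_minus_distrib_mat_vec[OF A])
  moreover have bc: "b \<in> carrier_vec (dim_row A)" using mult_mat_vec_carrier[OF A xc(1)] xc by simp
  ultimately have A\<Delta>: "A *\<^sub>v \<Delta> = b" by auto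
  have P\<Delta>: "(P *\<^sub>v \<Delta>) $ i = (P *\<^sub>v x) $ i - s i" if "i < m" for i
    unfolding \<Delta>_def using that xc z P' sz by (simp add: mult_minus_distrib_mat_vec[OF P'])
  have "energy P r \<Delta> \<le> energy P r y" if y: "feasible A b y" for y
  proof -
    have yc: "y \<in> carrier_vec n" "A *\<^sub>v y = b" using y by (auto simp: feasible_def n_def)
    let ?v = "\<lambda>i. (P *\<^sub>v \<Delta>) $ i" and ?g = "\<lambda>i. (P *\<^sub>v (y - \<Delta>)) $ i"
    have "A *\<^sub>v (y - \<Delta>) = b - b" using yc \<Delta>c A\<Delta> by (simp add: mult_minus_distrib_mat_vec[OF A])
    then have "y - \<Delta> \<in> Z" using yc \<Delta>c bc by (simp add: Z_def)
    then have "(\<Sum>i<m. r $ i * ((P *\<^sub>v x) $ i - s i) * (if i < m then ?g i else 0)) = 0"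
      by (intro s(2)) (auto simp: S_def)
    also have "(\<Sum>i<m. r $ i * ((P *\<^sub>v x) $ i - s i) * (if i < m then ?g i else 0))
        = (\<Sum>i<m. r $ i * ?v i * ?g i)"
      using P\<Delta> by (intro sum.cong) auto
    finally have orth: "(\<Sum>i<m. r $ i * ?v i * ?g i) = 0" .
    have "?v i + ?g i = (P *\<^sub>v y) $ i" if "i < m" for i
      using that yc \<Delta>c P' by (simp add: mult_minus_distrib_mat_vec[OF P'])
    then have "energy P r y = (\<Sum>i<m. r $ i * (?v i + ?g i)\<^sup>2)"
      unfolding energy_def using P' by (intro sum.cong) auto
    also have "\<dots> = energy P r \<Delta> + 2 * (\<Sum>i<m. r $ i * ?v i * ?g i) + (\<Sum>i<m. r $ i * (?g i)\<^sup>2)"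
      unfolding energy_def sum_distrib_left carrier_matD(1)[OF P'] sum.distrib[symmetric]
      by (intro sum.cong) (auto simp: algebra_simps power2_eq_square)
    finally show ?thesis using orth r by (auto intro!: sum_nonneg simp: less_imp_le)
  qed
  then show ?thesis
    using A\<Delta> \<Delta>c by (intro exI[of _ \<Delta>]) (force simp: is_arg_min_linorder feasible_def n_def)
qed

text \<open>First-order optimality: moving from \<open>\<Delta>\<close> towards \<open>y\<close> by
  a factor \<open>s\<close> changes the energy by \<open>2 * s * c + s\<^sup>2 * q\<close>, which is
  never negative, so the mixed term \<open>c\<close> is not negative. The proof uses minimality
  alone, since the algorithm may pick any minimizer.\<close>

lemma energy_argmin_pythagoras:
  assumes min: "is_arg_min (energy P r) (feasible A b) \<Delta>" and y: "feasible A b y"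
    and P: "P \<in> carrier_mat m (dim_col A)"
    and r: "\<And>i. i < m \<Longrightarrow> 0 \<le> r $ i"
  shows "energy P r \<Delta> + (\<Sum>i<m. r $ i * ((P *\<^sub>v y) $ i - (P *\<^sub>v \<Delta>) $ i)\<^sup>2) \<le> energy P r y"
proof -
  define n where "n = dim_col A"
  have P': "P \<in> carrier_mat m n" and A: "A \<in> carrier_mat (dim_row A) n"
    and yc: "y \<in> carrier_vec n" "A *\<^sub>v y = b"
    and \<Delta>c: "\<Delta> \<in> carrier_vec n" "A *\<^sub>v \<Delta> = b"
    using assms by (auto simp: n_def feasible_def is_arg_min_linorder)
  define v where "v i = (P *\<^sub>v \<Delta>) $ i" for i
  define g where "g i = (P *\<^sub>v y) $ i - (P *\<^sub>v \<Delta>) $ i" for i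
  define q where "q = (\<Sum>i<m. r $ i * (g i)\<^sup>2)"
  define c where "c = (\<Sum>i<m. r $ i * v i * g i)"
  have expand: "(\<Sum>i<m. r $ i * (v i + s * g i)\<^sup>2) = energy P r \<Delta> + 2 * s * c + s\<^sup>2 * q" for s
    unfolding energy_def sum_distrib_left sum.distrib[symmetric] c_def q_def v_def using P'
    by (simp add: algebra_simps power2_eq_square sum.distrib)
  have q: "0 \<le> q" unfolding q_def using r by (intro sum_nonneg) auto
  have var: "0 \<le> 2 * s * c + s\<^sup>2 * q" for s
  proof -
    have "A *\<^sub>v (\<Delta> + s \<cdot>\<^sub>v (y - \<Delta>)) = b + s \<cdot>\<^sub>v (b - b)"
      using yc \<Delta>c
      by (simp add: mult_add_distrib_mat_vec[OF A] mult_mat_vec[OF A]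
          mult_minus_distrib_mat_vec[OF A])
    also have "\<dots> = b" by (intro eq_vecI) simp_all
    finally have "feasible A b (\<Delta> + s \<cdot>\<^sub>v (y - \<Delta>))"
      using yc \<Delta>c by (simp add: feasible_def n_def[symmetric])
    then have "energy P r \<Delta> \<le> energy P r (\<Delta> + s \<cdot>\<^sub>v (y - \<Delta>))"
      using min by (simp add: is_arg_min_linorder)
    also have "\<dots> = (\<Sum>i<m. r $ i * (v i + s * g i)\<^sup>2)"
      unfolding energy_def using P' yc \<Delta>c
      by (intro sum.cong) (auto simp: v_def g_def mult_add_distrib_mat_vec[OF P']
          mult_mat_vec[OF P'] mult_minus_distrib_mat_vec[OF P'])
    finally show ?thesis unfolding expand by simp
  qed
  have "0 \<le> c"
  proof (rule ccontr)
    assume c: "\<not> 0 \<le> c"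
    \<comment> \<open>For \<open>0 < q\<close> the quadratic is minimal at \<open>- c / q\<close>;
      the extra 1 covers \<open>q = 0\<close> and still gives a negative value.\<close>
    define s where "s = - c / (q + 1)"
    have s: "0 < s" "s * (q + 1) = - c" using c q by (auto simp: s_def field_simps)
    have "2 * s * c + s\<^sup>2 * q = s * (2 * c + s * (q + 1) - s)"
      by (simp add: algebra_simps power2_eq_square)
    also have "\<dots> = s * (c - s)" using s by simp
    also have "\<dots> < 0" using s c by (simp add: mult_pos_neg)
    finally show False using var[of s] by simp
  qed
  moreover have "energy P r y = (\<Sum>i<m. r $ i * (v i + 1 * g i)\<^sup>2)"
    unfolding energy_def using P' by (simp add: v_def g_def)
  ultimately show ?thesis unfolding expand by (simp add: q_def g_def)
qed

section \<open>Growth of the second derivative\<close>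

lemma d2_nonneg: "quasi_self_concordant M f \<Longrightarrow> 0 < M \<Longrightarrow> 0 \<le> d2 f u"
  unfolding quasi_self_concordant_def by (smt (verit) mult_pos_neg)

text \<open>Integrated form of \<open>\<bar>d3 f u\<bar> \<le> M * d2 f u\<close>:
  \<open>exp (- (M * x)) * d2 f x\<close> is non-increasing and \<open>exp (M * x) * d2 f x\<close>
  is non-decreasing. The first bound serves non-decreasing \<open>f''\<close>, the second one
  non-increasing \<open>f''\<close>.\<close>

lemma d2_growth:
  assumes C3: "C3 f" and qsc: "quasi_self_concordant M f" and "0 \<le> \<delta>"
  shows "d2 f (u + \<delta>) \<le> exp (M * \<delta>) * d2 f u" "exp (- (M * \<delta>)) * d2 f u \<le> d2 f (u + \<delta>)"
proof -
  have der: "(d2 f has_real_derivative d3 f u) (at u)" for u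
  proof -
    have "d2 f field_differentiable at u" using C3 unfolding C3_def by (metis less_add_one numeral_3_eq_3 numeral_2_eq_2 lessI)
    then have "(d2 f has_real_derivative deriv (d2 f) u) (at u)"
      using DERIV_deriv_iff_field_differentiable by blast
    moreover have "deriv (d2 f) = d3 f" by (simp add: numeral_3_eq_3 numeral_2_eq_2)
    ultimately show ?thesis by simp
  qed
  have bound: "d3 f u \<le> M * d2 f u" "- d3 f u \<le> M * d2 f u" for u
    using qsc unfolding quasi_self_concordant_def by (meson abs_le_D1 abs_le_D2)+
  have "exp (- (M * (u + \<delta>))) * d2 f (u + \<delta>) \<le> exp (- (M * u)) * d2 f u"
  proof (rule DERIV_nonpos_imp_nonincreasing[of u "u + \<delta>" "\<lambda>x. exp (- (M * x)) * d2 f x"])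
    fix x
    have "((\<lambda>x. exp (- (M * x)) * d2 f x) has_real_derivative
        exp (- (M * x)) * (d3 f x - M * d2 f x)) (at x)"
      by (auto intro!: derivative_eq_intros der simp: algebra_simps)
    moreover have "exp (- (M * x)) * (d3 f x - M * d2 f x) \<le> 0"
      using bound(1)[of x] by (intro mult_nonneg_nonpos) auto
    ultimately show "\<exists>y. ((\<lambda>x. exp (- (M * x)) * d2 f x) has_real_derivative y) (at x) \<and> y \<le> 0"
      by blast
  qed (use assms in auto)
  then have "exp (M * (u + \<delta>)) * (exp (- (M * (u + \<delta>))) * d2 f (u + \<delta>))
      \<le> exp (M * (u + \<delta>)) * (exp (- (M * u)) * d2 f u)" by simp
  then show "d2 f (u + \<delta>) \<le> exp (M * \<delta>) * d2 f u"
    by (simp add: mult.assoc[symmetric] exp_add[symmetric] algebra_simps)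
  have "exp (M * u) * d2 f u \<le> exp (M * (u + \<delta>)) * d2 f (u + \<delta>)"
  proof (rule DERIV_nonneg_imp_nondecreasing[of u "u + \<delta>" "\<lambda>x. exp (M * x) * d2 f x"])
    fix x
    have "((\<lambda>x. exp (M * x) * d2 f x) has_real_derivative
        exp (M * x) * (d3 f x + M * d2 f x)) (at x)"
      by (auto intro!: derivative_eq_intros der simp: algebra_simps)
    moreover have "0 \<le> exp (M * x) * (d3 f x + M * d2 f x)"
      using bound(2)[of x] by (intro mult_nonneg_nonneg) auto
    ultimately show "\<exists>y. ((\<lambda>x. exp (M * x) * d2 f x) has_real_derivative y) (at x) \<and> 0 \<le> y"
      by blast
  qed (use assms in auto)
  then have "exp (- (M * (u + \<delta>))) * (exp (M * u) * d2 f u)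
      \<le> exp (- (M * (u + \<delta>))) * (exp (M * (u + \<delta>)) * d2 f (u + \<delta>))" by simp
  then show "exp (- (M * \<delta>)) * d2 f u \<le> d2 f (u + \<delta>)"
    by (simp add: mult.assoc[symmetric] exp_add[symmetric] algebra_simps)
qed

section \<open>Single steps\<close>

text \<open>Only inequalities between the parameters enter the analysis, not the formulas that
  produce them. \<open>\<Lambda>\<close> dominates the logarithm of the a priori ratio plus the
  total effect of the flow steps; the logarithm is demanded for \<open>0 < \<mu>\<close> only, where
  it makes sense. \<open>tau_Lam\<close> keeps the energy rate below 1/2, \<open>tau_cube\<close>
  compares the share of one wide coordinate with that rate, and \<open>T_tau\<close> keeps the
  weight increments of flow steps small.\<close>

locale qsc_mwu =
  fixes d n m :: nat and A :: "real mat" and b :: "real vec" and P :: "real mat"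
    and f :: "real \<Rightarrow> real" and M :: real and w0 xs :: "real vec"
    and R \<epsilon> \<tau> \<alpha> :: real and T :: nat and \<mu> \<Lambda> :: real
  assumes A: "A \<in> carrier_mat d n" and P: "P \<in> carrier_mat m n"
    and C3: "C3 f" and M: "0 < M" and qsc: "quasi_self_concordant M f"
    and w0: "w0 \<in> carrier_vec m" and w0_nonneg: "\<And>i. i < m \<Longrightarrow> 0 \<le> w0 $ i"
    and potential_w0: "0 < potential f w0"
    and xs: "feasible A b xs" "linf_norm (P *\<^sub>v xs) \<le> R"
    and R: "0 < R" and eps: "0 < \<epsilon>" and alpha: "0 < \<alpha>" and T: "0 < T"
    and alpha_T: "\<alpha> * M * \<epsilon> * real T = 1"
    and mu_nonneg: "0 \<le> \<mu>"
    and mu_le: "\<And>y. feasible A b y \<Longrightarrow> \<mu> \<le> (\<Sum>i<m. ((P *\<^sub>v y) $ i)\<^sup>2)"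
    and mu_attained: "\<exists>y. feasible A b y \<and> (\<Sum>i<m. ((P *\<^sub>v y) $ i)\<^sup>2) = \<mu>"
    and Lam: "1 + 3 * \<epsilon> \<le> \<Lambda>"
      "0 < \<mu> \<Longrightarrow> 1 + 3 * \<epsilon> + ln ((1 + \<epsilon>) * real m * R\<^sup>2 / (\<epsilon> * \<mu>)) \<le> \<Lambda>"
    and tau_Lam: "4 * \<Lambda> \<le> \<tau>"
    and tau_cube: "4 * \<Lambda> * (1 + \<epsilon>)\<^sup>2 * real m \<le> \<epsilon>\<^sup>2 * \<tau> ^ 3"
    and T_tau: "\<tau> * (1 + \<epsilon>) \<le> \<epsilon> * real T"
begin

section \<open>Potential, resistances and energy for one weight vector\<close>

definition \<rho> :: "real vec \<Rightarrow> nat \<Rightarrow> real" where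
  "\<rho> w i = resistance f R \<epsilon> w $ i"

text \<open>\<open>T\<close> flow steps at this rate and at most \<open>\<tau>\<close> width
  reductions at \<open>width_rate\<close> add up to \<open>1 + 4 * \<epsilon>\<close>, the exponent
  in the final potential bounds.\<close>

definition flow_rate :: real where "flow_rate = (1 + 3 * \<epsilon>) / real T"
definition width_rate :: real where "width_rate = \<epsilon> / \<tau>"
definition energy_rate :: real where "energy_rate = 2 * \<Lambda> / \<tau>"

lemma tau_pos: "0 < \<tau>" and tau_ge: "1 + \<epsilon> \<le> \<tau>" "1 + 3 * \<epsilon> \<le> \<tau>"
  using tau_Lam Lam(1) eps by auto

lemma m_pos: "0 < m"
  using potential_w0 w0 by (cases m) (auto simp: potential_def)

lemma d2_f_nonneg: "0 \<le> d2 f u"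
  using d2_nonneg[OF qsc M] .

lemma potential_eq: "w \<in> carrier_vec m \<Longrightarrow> potential f w = (\<Sum>i<m. d2 f (w $ i))"
  by (auto simp: potential_def)

lemma potential_nonneg: "0 \<le> potential f w"
  unfolding potential_def by (intro sum_nonneg d2_f_nonneg)

lemma \<rho>_eq:
  assumes "w \<in> carrier_vec m" "i < m"
  shows "R\<^sup>2 * \<rho> w i = d2 f (w $ i) + \<epsilon> * potential f w / real m"
  using assms R unfolding \<rho>_def resistance_def by (auto simp: field_simps)

lemma \<rho>_nonneg: "w \<in> carrier_vec m \<Longrightarrow> i < m \<Longrightarrow> 0 \<le> \<rho> w i"
proof -
  assume w: "w \<in> carrier_vec m" "i < m"
  have "0 \<le> R\<^sup>2 * \<rho> w i"
    unfolding \<rho>_eq[OF w] using d2_f_nonneg eps potential_nonneg by (intro add_nonneg_nonneg) auto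
  then show ?thesis using R by (simp add: zero_le_mult_iff)
qed

text \<open>The uniform floor due to the term \<open>\<epsilon> * potential f w / real m\<close>. It
  makes resistances positive, bounds all energies from below, and ensures that a single wide
  coordinate already carries a noticeable part of the energy.\<close>

lemma \<rho>_ge: "w \<in> carrier_vec m \<Longrightarrow> i < m \<Longrightarrow> \<epsilon> * potential f w / real m \<le> R\<^sup>2 * \<rho> w i"
  by (simp add: \<rho>_eq d2_f_nonneg)

lemma \<rho>_pos: "w \<in> carrier_vec m \<Longrightarrow> i < m \<Longrightarrow> 0 < potential f w \<Longrightarrow> 0 < \<rho> w i"
proof -
  assume w: "w \<in> carrier_vec m" "i < m" "0 < potential f w"
  have "0 < \<epsilon> * potential f w / real m" using w eps by simp
  then have "0 < R\<^sup>2 * \<rho> w i" using \<rho>_ge[OF w(1,2)] by linarith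
  then show ?thesis by (simp add: zero_less_mult_iff)
qed

lemma \<rho>_mono:
  assumes w: "w \<in> carrier_vec m" "w' \<in> carrier_vec m" and i: "i < m"
    and le: "d2 f (w $ i) \<le> d2 f (w' $ i)" "potential f w \<le> potential f w'"
  shows "\<rho> w i \<le> \<rho> w' i"
proof -
  have "\<epsilon> * potential f w / real m \<le> \<epsilon> * potential f w' / real m"
    using eps le by (intro divide_right_mono mult_left_mono) auto
  then have "R\<^sup>2 * \<rho> w i \<le> R\<^sup>2 * \<rho> w' i"
    using le by (simp add: \<rho>_eq w i)
  then show ?thesis using R by (simp add: mult_le_cancel_left)
qed

lemma sum_\<rho>: "w \<in> carrier_vec m \<Longrightarrow> R\<^sup>2 * (\<Sum>i<m. \<rho> w i) = (1 + \<epsilon>) * potential f w"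
proof -
  assume w: "w \<in> carrier_vec m"
  have "R\<^sup>2 * (\<Sum>i<m. \<rho> w i) = (\<Sum>i<m. d2 f (w $ i) + \<epsilon> * potential f w / real m)"
    unfolding sum_distrib_left by (intro sum.cong) (auto simp: \<rho>_eq w)
  also have "\<dots> = potential f w + \<epsilon> * potential f w"
    using m_pos by (simp add: sum.distrib potential_eq[OF w])
  finally show ?thesis by (simp add: algebra_simps)
qed

abbreviation en :: "real vec \<Rightarrow> real vec \<Rightarrow> real" where
  "en w \<equiv> energy P (resistance f R \<epsilon> w)"

lemma en_eq: "en w y = (\<Sum>i<m. \<rho> w i * ((P *\<^sub>v y) $ i)\<^sup>2)"
  unfolding energy_def \<rho>_def using P by simp

lemma en_nonneg: "w \<in> carrier_vec m \<Longrightarrow> 0 \<le> en w y"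
  unfolding en_eq by (intro sum_nonneg mult_nonneg_nonneg \<rho>_nonneg) auto

lemma en_mono: "(\<And>i. i < m \<Longrightarrow> \<rho> w i \<le> \<rho> w' i) \<Longrightarrow> en w y \<le> en w' y"
  unfolding en_eq by (intro sum_mono mult_right_mono) auto

lemma en_xs:
  assumes w: "w \<in> carrier_vec m"
  shows "en w xs \<le> (1 + \<epsilon>) * potential f w"
proof -
  have "en w xs \<le> (\<Sum>i<m. \<rho> w i * R\<^sup>2)"
    unfolding en_eq
  proof (intro sum_mono mult_left_mono)
    fix i assume i: "i \<in> {..<m}"
    have "\<bar>(P *\<^sub>v xs) $ i\<bar> \<le> R"
      using linf_norm_ge[of i "P *\<^sub>v xs"] xs P i by simp
    then show "((P *\<^sub>v xs) $ i)\<^sup>2 \<le> R\<^sup>2"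
      using R abs_le_square_iff[of "(P *\<^sub>v xs) $ i" R] by simp
    show "0 \<le> \<rho> w i" using \<rho>_nonneg[OF w] i by simp
  qed
  also have "\<dots> = (1 + \<epsilon>) * potential f w"
    using sum_\<rho>[OF w] by (simp add: sum_distrib_left mult.commute)
  finally show ?thesis .
qed

lemma argmin_le:
  assumes "w \<in> carrier_vec m" "is_arg_min (en w) (feasible A b) \<Delta>"
  shows "en w \<Delta> \<le> (1 + \<epsilon>) * potential f w"
  using assms en_xs[OF assms(1)] xs(1) by (auto simp: is_arg_min_linorder intro: order_trans)

lemma en_ge:
  assumes w: "w \<in> carrier_vec m" and y: "feasible A b y"
  shows "\<epsilon> * potential f w * \<mu> / (real m * R\<^sup>2) \<le> en w y"
proof -
  let ?c = "\<epsilon> * potential f w / real m / R\<^sup>2"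
  have c: "?c \<le> \<rho> w i" if "i < m" for i
    using \<rho>_ge[OF w that] R by (subst pos_divide_le_eq) (simp_all add: mult.commute)
  have "0 \<le> ?c" using eps potential_nonneg by auto
  then have "?c * \<mu> \<le> ?c * (\<Sum>i<m. ((P *\<^sub>v y) $ i)\<^sup>2)"
    using mu_le[OF y] by (rule mult_left_mono[rotated])
  also have "\<dots> \<le> en w y"
    unfolding en_eq sum_distrib_left using c by (intro sum_mono mult_right_mono) auto
  finally show ?thesis by (simp add: field_simps)
qed

section \<open>Comparison of two ordered weight vectors\<close>

context
  fixes w w' :: "real vec"
  assumes w: "w \<in> carrier_vec m" and w': "w' \<in> carrier_vec m"
    and w_ge: "\<And>i. i < m \<Longrightarrow> w0 $ i \<le> w $ i" and le: "\<And>i. i < m \<Longrightarrow> w $ i \<le> w' $ i"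
begin

lemma nondecr_potential_\<rho>_mono:
  assumes nondecr: "nondecr_beyond w0 (d2 f)"
  shows "potential f w \<le> potential f w'" and "i < m \<Longrightarrow> \<rho> w i \<le> \<rho> w' i"
proof -
  have d2: "d2 f (w $ i) \<le> d2 f (w' $ i)" if "i < m" for i
    using nondecr w_ge[OF that] le[OF that] that w0
      mono_onD[of "{w0 $ i..}" "d2 f" "w $ i" "w' $ i"]
    by (simp add: nondecr_beyond_def)
  then show pot: "potential f w \<le> potential f w'"
    unfolding potential_eq[OF w] potential_eq[OF w'] by (intro sum_mono) auto
  show "\<rho> w i \<le> \<rho> w' i" if "i < m"
    using that by (intro \<rho>_mono w w' d2 pot)
qed

lemma nonincr_potential_\<rho>_antimono:
  assumes nonincr: "nonincr_beyond w0 (d2 f)"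
  shows "potential f w' \<le> potential f w" and "i < m \<Longrightarrow> \<rho> w' i \<le> \<rho> w i"
proof -
  have d2: "d2 f (w' $ i) \<le> d2 f (w $ i)" if "i < m" for i
    using nonincr w_ge[OF that] le[OF that] that w0
      monotone_onD[of "{w0 $ i..}" "(\<le>)" "(\<ge>)" "d2 f" "w $ i" "w' $ i"]
    by (simp add: nonincr_beyond_def)
  then show pot: "potential f w' \<le> potential f w"
    unfolding potential_eq[OF w] potential_eq[OF w'] by (intro sum_mono) auto
  show "\<rho> w' i \<le> \<rho> w i" if "i < m"
    using that by (intro \<rho>_mono w w' d2 pot)
qed

end

section \<open>Flow steps\<close>

context
  fixes w \<Delta> :: "real vec"
  assumes w: "w \<in> carrier_vec m" and argmin: "is_arg_min (en w) (feasible A b) \<Delta>"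
begin

private abbreviation v :: "nat \<Rightarrow> real" where "v \<equiv> \<lambda>i. (P *\<^sub>v \<Delta>) $ i"

(* AM-GM in the form 2 s <= 1 + s^2, which spares the square roots of Cauchy-Schwarz. *)
lemma flow_sum: "(\<Sum>i<m. d2 f (w $ i) * (\<bar>v i\<bar> / R)) \<le> (1 + \<epsilon> / 2) * potential f w"
proof -
  have "(\<Sum>i<m. d2 f (w $ i) * (\<bar>v i\<bar> / R)) \<le> (\<Sum>i<m. (d2 f (w $ i) + \<rho> w i * (v i)\<^sup>2) / 2)"
  proof (rule sum_mono)
    fix i assume i: "i \<in> {..<m}"
    define s where "s = \<bar>v i\<bar> / R"
    have s: "(v i)\<^sup>2 = R\<^sup>2 * s\<^sup>2" using R by (simp add: s_def power_divide)
    have "0 \<le> (s - 1)\<^sup>2" by simp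
    then have "2 * s \<le> 1 + s\<^sup>2" by (simp add: power2_eq_square algebra_simps)
    then have "d2 f (w $ i) * (2 * s) \<le> d2 f (w $ i) * (1 + s\<^sup>2)"
      using d2_f_nonneg by (rule mult_left_mono)
    moreover have "d2 f (w $ i) * s\<^sup>2 \<le> (R\<^sup>2 * \<rho> w i) * s\<^sup>2"
      using i eps potential_nonneg by (intro mult_right_mono) (auto simp: \<rho>_eq w)
    ultimately show "d2 f (w $ i) * (\<bar>v i\<bar> / R) \<le> (d2 f (w $ i) + \<rho> w i * (v i)\<^sup>2) / 2"
      unfolding s s_def[symmetric] by (simp add: algebra_simps)
  qed
  also have "\<dots> = (potential f w + en w \<Delta>) / 2"
    by (simp add: en_eq potential_eq[OF w] sum.distrib sum_divide_distrib[symmetric])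
  also have "\<dots> \<le> (1 + \<epsilon> / 2) * potential f w"
    using argmin_le[OF w argmin] by (simp add: algebra_simps)
  finally show ?thesis .
qed

context
  fixes w' :: "real vec"
  assumes narrow: "linf_norm (P *\<^sub>v \<Delta>) \<le> R * \<tau>"
    and w': "w' = w + (\<epsilon> * \<alpha> / R) \<cdot>\<^sub>v abs_vec (P *\<^sub>v \<Delta>)"
begin

lemma flow_weight: "i < m \<Longrightarrow> w' $ i = w $ i + \<epsilon> * \<alpha> / R * \<bar>v i\<bar>"
  using carrier_matD(1)[OF P] by (simp add: w' abs_vec_def)

lemma flow_weight_carrier: "w' \<in> carrier_vec m"
  using carrier_matD(1)[OF P] by (intro carrier_vecI) (simp add: w' abs_vec_def)

lemma flow_weight_ge: "i < m \<Longrightarrow> w $ i \<le> w' $ i"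
  using eps alpha R by (simp add: flow_weight)

private lemma step_size: "M * (\<epsilon> * \<alpha> / R * \<bar>v i\<bar>) = \<bar>v i\<bar> / R / real T"
proof -
  have "M * \<epsilon> * \<alpha> = 1 / real T" using alpha_T T by (simp add: field_simps)
  moreover have "M * (\<epsilon> * \<alpha> / R * \<bar>v i\<bar>) = (M * \<epsilon> * \<alpha>) * (\<bar>v i\<bar> / R)" by simp
  ultimately show ?thesis by simp
qed

text \<open>\<open>T\<close> is so large that the exponent in the growth bound for
  \<open>f''\<close> stays below \<open>\<epsilon> / (1 + \<epsilon>)\<close> in a narrow step;
  linearizing \<open>exp\<close> then costs only a relative error of order \<epsilon>.\<close>

private lemma step_size_le: "i < m \<Longrightarrow> \<bar>v i\<bar> / R / real T \<le> \<epsilon> / (1 + \<epsilon>)"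
proof -
  assume i: "i < m"
  have "\<bar>v i\<bar> \<le> R * \<tau>" using narrow linf_norm_ge[of i "P *\<^sub>v \<Delta>"] P i by simp
  then have "\<bar>v i\<bar> / R / real T \<le> \<tau> / real T"
    using R by (intro divide_right_mono) (auto simp: field_simps)
  also have "\<dots> \<le> \<epsilon> / (1 + \<epsilon>)" using T_tau T eps by (simp add: field_simps)
  finally show ?thesis .
qed

text \<open>On \<open>[0, X]\<close> the exponential lies below \<open>1 + (1 + X) * s\<close>,
  which reduces the growth of all coordinates to the linear sum of \<open>flow_sum\<close>.\<close>

lemma flow_potential_le: "potential f w' \<le> potential f w * exp flow_rate"
proof -
  \<comment> \<open>With this value \<open>X + X * \<epsilon> = \<epsilon>\<close>, which keeps
    \<open>(1 + X) * (1 + \<epsilon> / 2)\<close> below \<open>1 + 3 * \<epsilon>\<close>.\<close>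
  define X where "X = \<epsilon> / (1 + \<epsilon>)"
  have X: "0 \<le> X" "X \<le> 1" "X * (1 + \<epsilon>) = \<epsilon>" using eps by (auto simp: X_def field_simps)
  have "potential f w' \<le> (\<Sum>i<m. d2 f (w $ i) * (1 + (1 + X) * (\<bar>v i\<bar> / R / real T)))"
    unfolding potential_eq[OF flow_weight_carrier]
  proof (rule sum_mono)
    fix i assume i: "i \<in> {..<m}"
    define s where "s = \<bar>v i\<bar> / R / real T"
    have s: "0 \<le> s" "s \<le> X" using step_size_le[of i] i R by (auto simp: s_def X_def)
    have "exp s \<le> 1 + s + s\<^sup>2" using s X by (intro exp_bound) auto
    also have "\<dots> \<le> 1 + (1 + X) * s"
      using s mult_right_mono[of s X s] by (simp add: power2_eq_square algebra_simps)
    finally have e: "exp s \<le> 1 + (1 + X) * s" .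
    have "d2 f (w' $ i) \<le> exp s * d2 f (w $ i)"
      using d2_growth(1)[OF C3 qsc, of "\<epsilon> * \<alpha> / R * \<bar>v i\<bar>" "w $ i"] i eps alpha R
      by (simp only: step_size s_def flow_weight lessThan_iff) simp
    also have "\<dots> \<le> (1 + (1 + X) * s) * d2 f (w $ i)" using e d2_f_nonneg by (rule mult_right_mono)
    finally show "d2 f (w' $ i) \<le> d2 f (w $ i) * (1 + (1 + X) * (\<bar>v i\<bar> / R / real T))"
      by (simp add: s_def mult.commute)
  qed
  also have "\<dots> = potential f w + (1 + X) / real T * (\<Sum>i<m. d2 f (w $ i) * (\<bar>v i\<bar> / R))"
    by (simp add: potential_eq[OF w] sum_distrib_left algebra_simps sum.distrib)
  also have "\<dots> \<le> potential f w + (1 + X) / real T * ((1 + \<epsilon> / 2) * potential f w)"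
    using X by (intro add_left_mono mult_left_mono flow_sum) auto
  also have "\<dots> = potential f w * (1 + (1 + X) * (1 + \<epsilon> / 2) / real T)"
    using T by (simp add: field_simps)
  also have "\<dots> \<le> potential f w * (1 + flow_rate)"
  proof -
    have "0 \<le> X * \<epsilon>" "X * \<epsilon> \<le> \<epsilon>" using X eps by (simp_all add: mult_left_le_one_le)
    moreover have "(1 + X) * (1 + \<epsilon> / 2) = 1 + \<epsilon> / 2 + X + X * \<epsilon> / 2" "X + X * \<epsilon> = \<epsilon>"
      using X by (simp_all add: algebra_simps)
    ultimately have "(1 + X) * (1 + \<epsilon> / 2) \<le> 1 + 3 * \<epsilon>" using eps by linarith
    then have "(1 + X) * (1 + \<epsilon> / 2) / real T \<le> flow_rate"
      unfolding flow_rate_def by (intro divide_right_mono) auto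
    then show ?thesis using potential_nonneg by (intro mult_left_mono) auto
  qed
  also have "\<dots> \<le> potential f w * exp flow_rate"
    by (intro mult_left_mono exp_ge_add_one_self potential_nonneg)
  finally show ?thesis .
qed

text \<open>The bound \<open>1 - s \<le> exp (- s)\<close> holds for every \<open>s\<close>; the
  loss arises when the resulting factor \<open>1 - y\<close> is turned back into an exponential.
  This is done through \<open>1 \<le> (1 + a) * (1 - y)\<close>, where the gap between
  \<open>1 + \<epsilon> / 2\<close> and \<open>1 + 3 * \<epsilon>\<close> absorbs the product
  \<open>y * a\<close>.\<close>

lemma flow_potential_ge: "potential f w * exp (- flow_rate) \<le> potential f w'"
proof -
  define a where "a = flow_rate"
  define y where "y = (1 + \<epsilon> / 2) / real T"
  have T': "0 < real T" using T by simp
  have a: "0 < a" using eps T by (simp add: a_def flow_rate_def)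
  have "(1 + 3 * \<epsilon>) * (1 + \<epsilon>) \<le> \<tau> * (1 + \<epsilon>)"
    using tau_ge eps by (intro mult_right_mono) auto
  then have "(1 + 3 * \<epsilon>) * (1 + \<epsilon>) / real T \<le> \<epsilon>"
    using T_tau T' by (simp add: divide_le_eq)
  then have "(1 + \<epsilon>) * a \<le> \<epsilon>" by (simp add: a_def flow_rate_def mult.commute)
  moreover have "(1 + \<epsilon> / 2) * a \<le> (1 + \<epsilon>) * a" using a eps by (intro mult_right_mono) auto
  ultimately have "0 \<le> (1 + 3 * \<epsilon> - (1 + \<epsilon> / 2) - (1 + \<epsilon> / 2) * a) / real T"
    using eps by simp
  also have "\<dots> = a - y - y * a"
    using T' by (simp add: a_def flow_rate_def y_def field_simps)
  finally have "1 \<le> (1 + a) * (1 - y)" by (simp add: algebra_simps)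
  then have "exp (- a) \<le> 1 - y"
  proof -
    have "0 \<le> 1 - y" using \<open>1 \<le> (1 + a) * (1 - y)\<close> a by (smt (verit) mult_pos_neg)
    then have "1 \<le> exp a * (1 - y)"
      using \<open>1 \<le> (1 + a) * (1 - y)\<close> mult_right_mono[OF exp_ge_add_one_self[of a]] by fastforce
    then show ?thesis by (simp add: exp_minus field_simps)
  qed
  then have "potential f w * exp (- a) \<le> potential f w * (1 - y)"
    using potential_nonneg by (intro mult_left_mono) auto
  also have "\<dots> = potential f w - 1 / real T * ((1 + \<epsilon> / 2) * potential f w)"
    using T by (simp add: y_def field_simps)
  also have "\<dots> \<le> potential f w - 1 / real T * (\<Sum>i<m. d2 f (w $ i) * (\<bar>v i\<bar> / R))"
    by (intro diff_left_mono mult_left_mono flow_sum) auto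
  also have "\<dots> = (\<Sum>i<m. d2 f (w $ i) * (1 - \<bar>v i\<bar> / R / real T))"
    by (simp add: potential_eq[OF w] sum_distrib_left algebra_simps sum_subtractf)
  also have "\<dots> \<le> potential f w'"
    unfolding potential_eq[OF flow_weight_carrier]
  proof (rule sum_mono)
    fix i assume i: "i \<in> {..<m}"
    define s where "s = \<bar>v i\<bar> / R / real T"
    have "d2 f (w $ i) * (1 - s) \<le> d2 f (w $ i) * exp (- s)"
      using exp_ge_add_one_self[of "- s"] d2_f_nonneg by (intro mult_left_mono) auto
    also have "\<dots> \<le> d2 f (w' $ i)"
      using d2_growth(2)[OF C3 qsc, of "\<epsilon> * \<alpha> / R * \<bar>v i\<bar>" "w $ i"] i eps alpha R
      by (simp only: step_size s_def flow_weight lessThan_iff mult.commute[of _ "exp _"]) simp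
    finally show "d2 f (w $ i) * (1 - \<bar>v i\<bar> / R / real T) \<le> d2 f (w' $ i)"
      by (simp add: s_def)
  qed
  finally show ?thesis by (simp add: a_def)
qed

end

section \<open>Width reduction steps\<close>

context
  fixes H :: "nat set" and w' :: "real vec"
  assumes wide: "\<not> linf_norm (P *\<^sub>v \<Delta>) \<le> R * \<tau>"
    and w_ge: "\<forall>i<m. w0 $ i \<le> w $ i"
    and potential_pos: "0 < potential f w"
    and H: "H = wide_coords P R \<tau> \<Delta>"
    and change: "width_change f w0 R \<epsilon> H w w'"
begin

lemma width_coords: "H \<subseteq> {..<m}" "finite H" "H \<noteq> {}"
proof -
  show "H \<subseteq> {..<m}" using P by (auto simp: H wide_coords_def)
  then show "finite H" by (rule finite_subset) simp
  obtain i where "i < m" "R * \<tau> < \<bar>v i\<bar>"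
    using linf_norm_gt_obtains[OF wide] R tau_pos P by auto
  then have "i \<in> H" using P by (simp add: H wide_coords_def)
  then show "H \<noteq> {}" by blast
qed

lemma width_coords_ge: "i \<in> H \<Longrightarrow> R\<^sup>2 * \<tau>\<^sup>2 \<le> (v i)\<^sup>2"
proof -
  assume "i \<in> H"
  then have "R * \<tau> \<le> \<bar>v i\<bar>" unfolding H wide_coords_def by blast
  then have "(R * \<tau>)\<^sup>2 \<le> \<bar>v i\<bar>\<^sup>2" using R tau_pos by (intro power_mono) auto
  then show "R\<^sup>2 * \<tau>\<^sup>2 \<le> (v i)\<^sup>2" by (simp only: power_mult_distrib power2_abs)
qed

lemma width_weight_carrier: "w' \<in> carrier_vec m"
  using change carrier_vecD[OF w] unfolding width_change_def carrier_dim_vec by argo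

lemma width_weight_ge: "i < m \<Longrightarrow> w $ i \<le> w' $ i"
  using change carrier_vecD[OF w] unfolding width_change_def by (metis order_refl)

lemma width_weight_other: "i < m \<Longrightarrow> i \<notin> H \<Longrightarrow> w' $ i = w $ i"
  using change carrier_vecD[OF w] unfolding width_change_def by blast

private lemma sum_H_le: "(\<And>i. i < m \<Longrightarrow> 0 \<le> g i) \<Longrightarrow> sum g H \<le> sum g {..<m}" for g :: "nat \<Rightarrow> real"
  using width_coords by (intro sum_mono2) (auto simp: subset_iff)

text \<open>A Markov inequality: in the energy a wide coordinate multiplies its resistance by at
  least \<open>R\<^sup>2 * \<tau>\<^sup>2\<close>, and the whole energy is at most
  \<open>(1 + \<epsilon>) * potential f w\<close>.\<close>

lemma wide_resistance_le: "R\<^sup>2 * (\<Sum>i\<in>H. \<rho> w i) \<le> (1 + \<epsilon>) * potential f w / \<tau>\<^sup>2"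
proof -
  have "\<tau>\<^sup>2 * (R\<^sup>2 * (\<Sum>i\<in>H. \<rho> w i)) = (\<Sum>i\<in>H. \<rho> w i * (R\<^sup>2 * \<tau>\<^sup>2))"
    by (simp add: sum_distrib_left mult_ac)
  also have "\<dots> \<le> (\<Sum>i\<in>H. \<rho> w i * (v i)\<^sup>2)"
    using width_coords width_coords_ge \<rho>_nonneg[OF w] by (intro sum_mono mult_left_mono) auto
  also have "\<dots> \<le> en w \<Delta>"
    unfolding en_eq using \<rho>_nonneg[OF w] by (intro sum_H_le) auto
  also have "\<dots> \<le> (1 + \<epsilon>) * potential f w" by (rule argmin_le[OF w argmin])
  finally show ?thesis using tau_pos by (simp add: pos_le_divide_eq mult.commute)
qed

text \<open>The right-hand side is the change of energy that a width reduction guarantees in either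
  monotone case. Keeping a single wide coordinate \<open>j\<close> and the floor for its resistance
  reduces the claim to \<open>tau_cube\<close>. The factor 2 leaves room for passing between
  \<open>1 + 2 * energy_rate\<close> and \<open>exp energy_rate\<close>.\<close>

lemma wide_energy_gain:
  "2 * energy_rate * en w \<Delta> \<le> \<epsilon> / (1 + \<epsilon>) * (\<Sum>i\<in>H. \<rho> w i * (v i)\<^sup>2)"
proof -
  obtain j where j: "j \<in> H" "j < m" using width_coords by blast
  have "2 * energy_rate * en w \<Delta> \<le> 2 * energy_rate * ((1 + \<epsilon>) * potential f w)"
    using tau_pos Lam(1) eps
    by (intro mult_left_mono argmin_le[OF w argmin]) (auto simp: energy_rate_def)
  also have "\<dots> = 4 * \<Lambda> * (1 + \<epsilon>)\<^sup>2 * real m * (potential f w / (\<tau> * (1 + \<epsilon>) * real m))"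
    using tau_pos eps m_pos by (simp add: energy_rate_def power2_eq_square)
  also have "\<dots> \<le> \<epsilon>\<^sup>2 * \<tau> ^ 3 * (potential f w / (\<tau> * (1 + \<epsilon>) * real m))"
    using potential_nonneg tau_pos eps by (intro mult_right_mono tau_cube) auto
  also have "\<dots> = \<epsilon> / (1 + \<epsilon>) * (\<epsilon> * potential f w / real m * \<tau>\<^sup>2)"
    using tau_pos by (simp add: power2_eq_square power3_eq_cube)
  also have "\<dots> \<le> \<epsilon> / (1 + \<epsilon>) * (R\<^sup>2 * \<rho> w j * \<tau>\<^sup>2)"
    using eps by (intro mult_left_mono mult_right_mono \<rho>_ge[OF w j(2)]) auto
  also have "\<dots> = \<epsilon> / (1 + \<epsilon>) * (\<rho> w j * (R\<^sup>2 * \<tau>\<^sup>2))" by simp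
  also have "\<dots> \<le> \<epsilon> / (1 + \<epsilon>) * (\<rho> w j * (v j)\<^sup>2)"
    using eps by (intro mult_left_mono width_coords_ge j \<rho>_nonneg[OF w]) auto
  also have "\<dots> \<le> \<epsilon> / (1 + \<epsilon>) * (\<Sum>i\<in>H. \<rho> w i * (v i)\<^sup>2)"
    using eps width_coords \<rho>_nonneg[OF w]
    by (intro mult_left_mono member_le_sum[OF j(1), of "\<lambda>i. \<rho> w i * (v i)\<^sup>2"]) auto
  finally show ?thesis .
qed

lemma potential_diff: "potential f w' - potential f w = (\<Sum>i\<in>H. d2 f (w' $ i) - d2 f (w $ i))"
proof -
  have "potential f w' - potential f w = (\<Sum>i<m. d2 f (w' $ i) - d2 f (w $ i))"
    by (simp add: potential_eq[OF w] potential_eq[OF width_weight_carrier] sum_subtractf)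
  also have "\<dots> = (\<Sum>i\<in>H. d2 f (w' $ i) - d2 f (w $ i))"
    using width_coords width_weight_other by (intro sum.mono_neutral_right) auto
  finally show ?thesis .
qed

private lemma energy_rate: "0 < energy_rate" "energy_rate \<le> 1 / 2"
  using tau_Lam tau_pos Lam(1) eps by (auto simp: energy_rate_def field_simps)

private lemma width_gain_bound: "R\<^sup>2 * (\<Sum>i\<in>H. \<rho> w i) * \<epsilon> / (1 + \<epsilon>) \<le> potential f w * (\<epsilon> / \<tau>\<^sup>2)"
proof -
  have "R\<^sup>2 * (\<Sum>i\<in>H. \<rho> w i) * \<epsilon> / (1 + \<epsilon>) \<le> (1 + \<epsilon>) * potential f w / \<tau>\<^sup>2 * \<epsilon> / (1 + \<epsilon>)"
    using eps by (intro divide_right_mono mult_right_mono wide_resistance_le) auto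
  also have "\<dots> = potential f w * (\<epsilon> / \<tau>\<^sup>2)" using eps by simp
  finally show ?thesis .
qed

section \<open>Width reductions for non-decreasing \<open>f''\<close>\<close>

context
  assumes nondecr: "nondecr_beyond w0 (d2 f)"
begin

lemma width_potential_mono: "potential f w \<le> potential f w'"
  and width_\<rho>_mono: "i < m \<Longrightarrow> \<rho> w i \<le> \<rho> w' i"
  using nondecr_potential_\<rho>_mono[of w w'] w width_weight_carrier w_ge width_weight_ge nondecr
  by blast+

(* width_change lets either branch apply when f'' is both non-decreasing and non-increasing;
   monotonicity of the resistances rules out the wrong one. *)
lemma width_\<rho>_eq: "i \<in> H \<Longrightarrow> \<rho> w' i = (1 + \<epsilon>) * \<rho> w i"
proof -
  assume i: "i \<in> H"
  then have i': "i < m" using width_coords by auto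
  have pos: "0 < \<rho> w i" using \<rho>_pos[OF w i' potential_pos] .
  have "\<rho> w' i \<noteq> 1 / (1 + \<epsilon>) * \<rho> w i"
  proof
    assume "\<rho> w' i = 1 / (1 + \<epsilon>) * \<rho> w i"
    also have "\<dots> < \<rho> w i" using pos eps by (simp add: field_simps)
    finally show False using width_\<rho>_mono[OF i'] by simp
  qed
  then show ?thesis using change i unfolding width_change_def \<rho>_def by blast
qed

text \<open>What is prescribed is the change of the resistance, which contains the potential as
  well. Since the potential does not decrease, \<open>f''\<close> at a wide coordinate grows by no
  more than the scaled resistance does.\<close>

lemma width_potential_le: "potential f w' \<le> potential f w * exp width_rate"
proof -
  have "potential f w' - potential f w \<le> (\<Sum>i\<in>H. \<epsilon> * (R\<^sup>2 * \<rho> w i))"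
    unfolding potential_diff
  proof (rule sum_mono)
    fix i assume i: "i \<in> H"
    then have i': "i < m" using width_coords by auto
    have "\<epsilon> * potential f w / real m \<le> \<epsilon> * potential f w' / real m"
      using eps width_potential_mono by (intro divide_right_mono mult_left_mono) auto
    moreover have "R\<^sup>2 * \<rho> w' i - R\<^sup>2 * \<rho> w i = \<epsilon> * (R\<^sup>2 * \<rho> w i)"
      using width_\<rho>_eq[OF i] by (simp add: algebra_simps)
    ultimately show "d2 f (w' $ i) - d2 f (w $ i) \<le> \<epsilon> * (R\<^sup>2 * \<rho> w i)"
      using \<rho>_eq[OF w i'] \<rho>_eq[OF width_weight_carrier i'] by linarith
  qed
  also have "\<dots> = \<epsilon> * (R\<^sup>2 * (\<Sum>i\<in>H. \<rho> w i))" by (simp add: sum_distrib_left)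
  also have "\<dots> \<le> \<epsilon> * ((1 + \<epsilon>) * potential f w / \<tau>\<^sup>2)"
    using eps by (intro mult_left_mono wide_resistance_le) auto
  also have "\<dots> \<le> \<epsilon> * (\<tau> * potential f w / \<tau>\<^sup>2)"
    using eps tau_ge potential_nonneg by (intro mult_left_mono divide_right_mono mult_right_mono) auto
  also have "\<dots> = potential f w * width_rate"
    using tau_pos by (simp add: width_rate_def power2_eq_square)
  finally have "potential f w' \<le> potential f w * (1 + width_rate)" by (simp add: algebra_simps)
  also have "\<dots> \<le> potential f w * exp width_rate"
    by (intro mult_left_mono exp_ge_add_one_self potential_nonneg)
  finally show ?thesis .
qed

text \<open>The minimizer moves with the resistances, so every feasible \<open>y\<close> has to be
  bounded. The Pythagorean inequality charges \<open>y\<close> for its distance from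
  \<open>\<Delta>\<close>, the raised resistances charge it for its size, and on a wide coordinate
  both together cost at least \<open>\<epsilon> / (1 + \<epsilon>) * (v i)\<^sup>2\<close> per unit
  of resistance.\<close>

lemma width_energy_ge:
  assumes y: "feasible A b y"
  shows "en w \<Delta> * exp energy_rate \<le> en w' y"
proof -
  let ?y = "\<lambda>i. (P *\<^sub>v y) $ i"
  have dimA: "P \<in> carrier_mat m (dim_col A)" using A P by simp
  have "exp energy_rate \<le> 1 + energy_rate + energy_rate\<^sup>2"
    using energy_rate by (intro exp_bound) auto
  also have "\<dots> \<le> 1 + 2 * energy_rate"
    using energy_rate mult_left_mono[of energy_rate 1 energy_rate]
    by (simp add: power2_eq_square)
  finally have "en w \<Delta> * exp energy_rate \<le> en w \<Delta> * (1 + 2 * energy_rate)"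
    using en_nonneg[OF w] by (rule mult_left_mono)
  also have "\<dots> \<le> en w \<Delta> + \<epsilon> / (1 + \<epsilon>) * (\<Sum>i\<in>H. \<rho> w i * (v i)\<^sup>2)"
    using wide_energy_gain by (simp add: algebra_simps)
  also have "\<dots> \<le> en w \<Delta> + (\<Sum>i\<in>H. \<rho> w i * (?y i - v i)\<^sup>2 + \<epsilon> * (\<rho> w i * (?y i)\<^sup>2))"
    unfolding sum_distrib_left
  proof (intro add_left_mono sum_mono)
    fix i assume "i \<in> H"
    then have r: "0 \<le> \<rho> w i" using \<rho>_nonneg[OF w] width_coords by auto
    \<comment> \<open>As a quadratic in \<open>?y i\<close>, the sum of the two charges is minimal
      at \<open>v i / (1 + \<epsilon>)\<close>; this is its completed square.\<close>
    have "0 \<le> ((1 + \<epsilon>) * ?y i - v i)\<^sup>2 / (1 + \<epsilon>)" using eps by simp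
    also have "\<dots> = (?y i - v i)\<^sup>2 + \<epsilon> * (?y i)\<^sup>2 - \<epsilon> / (1 + \<epsilon>) * (v i)\<^sup>2"
      using eps by (simp add: field_simps power2_eq_square)
    finally have "\<rho> w i * (\<epsilon> / (1 + \<epsilon>) * (v i)\<^sup>2) \<le> \<rho> w i * ((?y i - v i)\<^sup>2 + \<epsilon> * (?y i)\<^sup>2)"
      using r by (intro mult_left_mono) auto
    then show "\<epsilon> / (1 + \<epsilon>) * (\<rho> w i * (v i)\<^sup>2)
        \<le> \<rho> w i * (?y i - v i)\<^sup>2 + \<epsilon> * (\<rho> w i * (?y i)\<^sup>2)"
      by (simp only: distrib_left mult_ac)
  qed
  also have "\<dots> \<le> en w y + \<epsilon> * (\<Sum>i\<in>H. \<rho> w i * (?y i)\<^sup>2)"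
  proof -
    have "en w \<Delta> + (\<Sum>i<m. \<rho> w i * (?y i - v i)\<^sup>2) \<le> en w y"
      using energy_argmin_pythagoras[OF argmin y dimA] \<rho>_nonneg[OF w] by (simp add: \<rho>_def)
    moreover have "(\<Sum>i\<in>H. \<rho> w i * (?y i - v i)\<^sup>2) \<le> (\<Sum>i<m. \<rho> w i * (?y i - v i)\<^sup>2)"
      using \<rho>_nonneg[OF w] by (intro sum_H_le) auto
    ultimately show ?thesis by (simp add: sum.distrib sum_distrib_left)
  qed
  also have "\<dots> \<le> en w y + (\<Sum>i<m. (\<rho> w' i - \<rho> w i) * (?y i)\<^sup>2)"
  proof -
    have "\<epsilon> * (\<Sum>i\<in>H. \<rho> w i * (?y i)\<^sup>2) = (\<Sum>i\<in>H. (\<rho> w' i - \<rho> w i) * (?y i)\<^sup>2)"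
      unfolding sum_distrib_left using width_\<rho>_eq by (intro sum.cong) (auto simp: algebra_simps)
    also have "\<dots> \<le> (\<Sum>i<m. (\<rho> w' i - \<rho> w i) * (?y i)\<^sup>2)"
      using width_\<rho>_mono by (intro sum_H_le) auto
    finally show ?thesis by simp
  qed
  also have "\<dots> = en w' y"
    by (simp add: en_eq sum.distrib[symmetric] left_diff_distrib)
  finally show ?thesis .
qed

end

section \<open>Width reductions for non-increasing \<open>f''\<close>\<close>

context
  assumes nonincr: "nonincr_beyond w0 (d2 f)"
begin

lemma width_potential_antimono: "potential f w' \<le> potential f w"
  and width_\<rho>_antimono: "i < m \<Longrightarrow> \<rho> w' i \<le> \<rho> w i"
  using nonincr_potential_\<rho>_antimono[of w w'] w width_weight_carrier w_ge width_weight_ge nonincr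
  by blast+

text \<open>Written as a loss, so that the fraction \<open>\<epsilon> / (1 + \<epsilon>)\<close>
  matches the one in \<open>wide_energy_gain\<close>.\<close>

lemma width_\<rho>_eq_nonincr: "i \<in> H \<Longrightarrow> \<rho> w' i = \<rho> w i - \<epsilon> / (1 + \<epsilon>) * \<rho> w i"
proof -
  assume i: "i \<in> H"
  then have i': "i < m" using width_coords by auto
  have pos: "0 < \<rho> w i" using \<rho>_pos[OF w i' potential_pos] .
  have "\<rho> w' i \<noteq> (1 + \<epsilon>) * \<rho> w i"
    using width_\<rho>_antimono[OF i'] mult_pos_pos[OF eps pos] by (simp add: algebra_simps)
  then have "\<rho> w' i = 1 / (1 + \<epsilon>) * \<rho> w i" using change i unfolding width_change_def \<rho>_def by blast
  also have "\<dots> = \<rho> w i - \<epsilon> / (1 + \<epsilon>) * \<rho> w i" using eps by (simp add: field_simps)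
  finally show ?thesis .
qed

text \<open>The relative loss is at most \<open>\<epsilon> / \<tau>\<^sup>2\<close>, while
  \<open>width_rate\<close> allows \<open>\<epsilon> / \<tau>\<close>. The difference pays for
  turning \<open>1 - \<epsilon> / \<tau>\<^sup>2\<close> into an exponential, by way of
  \<open>\<tau> + \<epsilon> \<le> \<tau> * \<tau>\<close>.\<close>

lemma width_potential_ge: "potential f w * exp (- width_rate) \<le> potential f w'"
proof -
  have "potential f w - potential f w' = (\<Sum>i\<in>H. d2 f (w $ i) - d2 f (w' $ i))"
    using potential_diff by (simp add: sum_subtractf)
  also have "\<dots> \<le> (\<Sum>i\<in>H. R\<^sup>2 * \<rho> w i * \<epsilon> / (1 + \<epsilon>))"
  proof (rule sum_mono)
    fix i assume i: "i \<in> H"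
    then have i': "i < m" using width_coords by auto
    have "\<epsilon> * potential f w' / real m \<le> \<epsilon> * potential f w / real m"
      using eps width_potential_antimono by (intro divide_right_mono mult_left_mono) auto
    moreover have "R\<^sup>2 * \<rho> w i - R\<^sup>2 * \<rho> w' i = R\<^sup>2 * \<rho> w i * \<epsilon> / (1 + \<epsilon>)"
      by (simp add: width_\<rho>_eq_nonincr[OF i] right_diff_distrib)
    ultimately show "d2 f (w $ i) - d2 f (w' $ i) \<le> R\<^sup>2 * \<rho> w i * \<epsilon> / (1 + \<epsilon>)"
      using \<rho>_eq[OF w i'] \<rho>_eq[OF width_weight_carrier i'] by linarith
  qed
  also have "\<dots> = R\<^sup>2 * (\<Sum>i\<in>H. \<rho> w i) * \<epsilon> / (1 + \<epsilon>)"
    by (simp only: sum_distrib_left sum_distrib_right sum_divide_distrib)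
  also have "\<dots> \<le> potential f w * (\<epsilon> / \<tau>\<^sup>2)" by (rule width_gain_bound)
  finally have le: "potential f w * (1 - \<epsilon> / \<tau>\<^sup>2) \<le> potential f w'" by (simp add: algebra_simps)
  have "(1 + \<epsilon>) * \<tau> \<le> \<tau> * \<tau>" using tau_ge tau_pos by (intro mult_right_mono) auto
  moreover have "\<epsilon> \<le> \<epsilon> * \<tau>" using tau_ge eps by simp
  ultimately have "\<tau> + \<epsilon> \<le> \<tau> * \<tau>" by (simp add: algebra_simps)
  then have "0 \<le> \<epsilon> * (\<tau> * \<tau> - \<tau> - \<epsilon>) / \<tau> ^ 3" using eps tau_pos by simp
  also have "\<dots> = (1 + width_rate) * (1 - \<epsilon> / \<tau>\<^sup>2) - 1"
    using tau_pos by (simp add: width_rate_def field_simps power2_eq_square power3_eq_cube)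
  finally have one: "1 \<le> (1 + width_rate) * (1 - \<epsilon> / \<tau>\<^sup>2)" by simp
  have "0 < width_rate" using eps tau_pos by (simp add: width_rate_def)
  then have "0 \<le> 1 - \<epsilon> / \<tau>\<^sup>2" using one by (smt (verit) mult_pos_neg)
  then have "1 \<le> exp width_rate * (1 - \<epsilon> / \<tau>\<^sup>2)"
    using one mult_right_mono[OF exp_ge_add_one_self[of width_rate]] by fastforce
  then have "exp (- width_rate) \<le> 1 - \<epsilon> / \<tau>\<^sup>2" by (simp add: exp_minus field_simps)
  then have "potential f w * exp (- width_rate) \<le> potential f w * (1 - \<epsilon> / \<tau>\<^sup>2)"
    using potential_nonneg by (rule mult_left_mono)
  then show ?thesis using le by simp
qed

text \<open>Here the least energy is to be bounded from above, so the old minimizer can serve as a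
  test vector for the new resistances.\<close>

lemma width_energy_le: "en w' \<Delta> \<le> en w \<Delta> * exp (- energy_rate)"
proof -
  have "\<epsilon> / (1 + \<epsilon>) * (\<Sum>i\<in>H. \<rho> w i * (v i)\<^sup>2) = (\<Sum>i\<in>H. (\<rho> w i - \<rho> w' i) * (v i)\<^sup>2)"
    unfolding sum_distrib_left by (intro sum.cong) (simp_all add: width_\<rho>_eq_nonincr)
  also have "\<dots> \<le> (\<Sum>i<m. (\<rho> w i - \<rho> w' i) * (v i)\<^sup>2)"
    using width_\<rho>_antimono by (intro sum_H_le) auto
  also have "\<dots> = en w \<Delta> - en w' \<Delta>"
    by (simp add: en_eq sum_subtractf left_diff_distrib)
  finally have "en w' \<Delta> \<le> en w \<Delta> * (1 - 2 * energy_rate)"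
    using wide_energy_gain by (simp add: algebra_simps)
  also have "\<dots> \<le> en w \<Delta> * exp (- energy_rate)"
    using exp_ge_add_one_self[of "- energy_rate"] energy_rate en_nonneg[OF w]
    by (intro mult_left_mono) auto
  finally show ?thesis .
qed

end

end

end

section \<open>Invariants\<close>

abbreviation step :: "mwu_state \<Rightarrow> mwu_state \<Rightarrow> bool" where
  "step \<equiv> mwu_step A b P f w0 R \<epsilon> \<tau> \<alpha> T"

abbreviation reachable :: "mwu_state \<Rightarrow> bool" where
  "reachable \<equiv> mwu_reachable A b P f w0 R \<epsilon> \<tau> \<alpha> T"

text \<open>The weights dominate the scaled length of the path travelled by \<open>P x\<close>,
  hence \<open>P x\<close> itself; this yields the final norm bound. The last conjunct remembers
  that a width reduction testifies to \<open>0 < \<mu>\<close>, which the counting argument needs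
  before taking logarithms.\<close>

definition iterate_inv :: "nat \<Rightarrow> nat \<Rightarrow> real vec \<Rightarrow> real vec \<Rightarrow> bool" where
  "iterate_inv t k x w \<longleftrightarrow>
     t \<le> T \<and> x \<in> carrier_vec n \<and> A *\<^sub>v x = real t \<cdot>\<^sub>v b \<and> w \<in> carrier_vec m \<and>
     (\<forall>i<m. w0 $ i \<le> w $ i \<and> \<epsilon> * \<alpha> / R * \<bar>(P *\<^sub>v x) $ i\<bar> \<le> w $ i) \<and> (0 < k \<longrightarrow> 0 < \<mu>)"

text \<open>The least energy has to grow, so all feasible vectors are bounded from below. The first
  conjunct keeps the potential positive.\<close>

definition nondecr_inv :: "nat \<Rightarrow> nat \<Rightarrow> real vec \<Rightarrow> bool" where
  "nondecr_inv t k w \<longleftrightarrow>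
     potential f w0 \<le> potential f w \<and>
     potential f w \<le> potential f w0 * exp (real t * flow_rate + real k * width_rate) \<and>
     (\<forall>y. feasible A b y \<longrightarrow>
        \<epsilon> * potential f w0 * \<mu> / (real m * R\<^sup>2) * exp (real k * energy_rate) \<le> en w y)"

text \<open>The least energy has to shrink, so one feasible witness is enough. Flow steps keep the
  witness; a width reduction replaces it by the current minimizer.\<close>

definition nonincr_inv :: "nat \<Rightarrow> nat \<Rightarrow> real vec \<Rightarrow> bool" where
  "nonincr_inv t k w \<longleftrightarrow>
     potential f w0 * exp (- (real t * flow_rate + real k * width_rate)) \<le> potential f w \<and>
     (\<exists>y. feasible A b y \<and>
        en w y \<le> (1 + \<epsilon>) * potential f w0 * exp (- (real k * energy_rate)))"

lemma feasible_carrier: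
  "feasible A b y \<longleftrightarrow> y \<in> carrier_vec n \<and> A *\<^sub>v y = b"
  using A by (simp add: feasible_def)

lemma b_carrier: "b \<in> carrier_vec d"
  using xs(1) mult_mat_vec_carrier[OF A] by (auto simp: feasible_carrier)

lemma argmin_exists:
  assumes "w \<in> carrier_vec m" "0 < potential f w"
  shows "\<exists>\<Delta>. is_arg_min (en w) (feasible A b) \<Delta>"
proof (rule energy_argmin_exists[OF xs(1)])
  show "P \<in> carrier_mat m (dim_col A)" using A P by simp
  show "0 < resistance f R \<epsilon> w $ i" if "i < m" for i
    using \<rho>_pos[OF assms(1) that assms(2)] by (simp add: \<rho>_def)
qed

text \<open>If \<mu> vanishes, a feasible vector with \<open>P y = 0\<close> has energy 0, hence so
  does the minimizer, and positive resistances force \<open>P \<Delta> = 0\<close>, which is not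
  wide.\<close>

lemma mu_pos_if_wide:
  assumes w: "w \<in> carrier_vec m" and pos: "0 < potential f w"
    and argmin: "is_arg_min (en w) (feasible A b) \<Delta>"
    and wide: "\<not> linf_norm (P *\<^sub>v \<Delta>) \<le> R * \<tau>"
  shows "0 < \<mu>"
proof (rule ccontr)
  assume "\<not> 0 < \<mu>"
  then have "\<mu> = 0" using mu_nonneg by simp
  then obtain y where y: "feasible A b y" "(\<Sum>i<m. ((P *\<^sub>v y) $ i)\<^sup>2) = 0"
    using mu_attained by blast
  have "(P *\<^sub>v y) $ i = 0" if "i < m" for i
    using y(2) that by (subst (asm) sum_nonneg_eq_0_iff) auto
  then have "en w y = 0" unfolding en_eq by simp
  then have "en w \<Delta> \<le> 0" using argmin y(1) by (auto simp: is_arg_min_linorder)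
  then have "en w \<Delta> = 0" using en_nonneg[OF w, of \<Delta>] by simp
  then have zero: "\<rho> w i * ((P *\<^sub>v \<Delta>) $ i)\<^sup>2 = 0" if "i < m" for i
    using that \<rho>_nonneg[OF w] unfolding en_eq by (subst (asm) sum_nonneg_eq_0_iff) auto
  have "(P *\<^sub>v \<Delta>) $ i = 0" if "i < m" for i
    using zero[OF that] \<rho>_pos[OF w that pos] by simp
  then have "linf_norm (P *\<^sub>v \<Delta>) \<le> 0" using P by (intro linf_norm_le) auto
  moreover have "0 \<le> R * \<tau>" using R tau_pos by simp
  ultimately show False using wide by simp
qed

section \<open>Preservation of the invariants\<close>

lemma iterate_inv_init: "iterate_inv 0 0 (0\<^sub>v (dim_col A)) w0"
proof -
  have "A *\<^sub>v 0\<^sub>v n = 0 \<cdot>\<^sub>v b"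
    using A b_carrier by (intro eq_vecI) (auto simp: scalar_prod_def)
  moreover have "(P *\<^sub>v 0\<^sub>v n) $ i = 0" if "i < m" for i
    using P that by (simp add: scalar_prod_def)
  ultimately show ?thesis using A w0 w0_nonneg by (simp add: iterate_inv_def)
qed

lemma iterate_inv_flow:
  assumes inv: "iterate_inv t k x w" and t: "t < T"
    and argmin: "is_arg_min (en w) (feasible A b) \<Delta>"
    and narrow: "linf_norm (P *\<^sub>v \<Delta>) \<le> R * \<tau>"
    and w': "w' = w + (\<epsilon> * \<alpha> / R) \<cdot>\<^sub>v abs_vec (P *\<^sub>v \<Delta>)"
  shows "iterate_inv (Suc t) k (x + \<Delta>) w'"
proof -
  have w: "w \<in> carrier_vec m" and x: "x \<in> carrier_vec n" "A *\<^sub>v x = real t \<cdot>\<^sub>v b"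
    using inv by (auto simp: iterate_inv_def)
  note flow = w argmin narrow w'
  have \<Delta>: "\<Delta> \<in> carrier_vec n" "A *\<^sub>v \<Delta> = b"
    using argmin by (auto simp: is_arg_min_linorder feasible_carrier)
  have "A *\<^sub>v (x + \<Delta>) = real t \<cdot>\<^sub>v b + b"
    using x \<Delta> by (simp add: mult_add_distrib_mat_vec[OF A])
  also have "\<dots> = real (Suc t) \<cdot>\<^sub>v b"
    by (intro eq_vecI) (simp_all add: algebra_simps)
  finally have Ax: "A *\<^sub>v (x + \<Delta>) = real (Suc t) \<cdot>\<^sub>v b" .
  have "\<epsilon> * \<alpha> / R * \<bar>(P *\<^sub>v (x + \<Delta>)) $ i\<bar> \<le> w' $ i" if i: "i < m" for i
  proof -
    have "(P *\<^sub>v (x + \<Delta>)) $ i = (P *\<^sub>v x) $ i + (P *\<^sub>v \<Delta>) $ i"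
      using i P x \<Delta> by (simp add: mult_add_distrib_mat_vec[OF P] del: index_mult_mat_vec)
    then have "\<epsilon> * \<alpha> / R * \<bar>(P *\<^sub>v (x + \<Delta>)) $ i\<bar>
        \<le> \<epsilon> * \<alpha> / R * (\<bar>(P *\<^sub>v x) $ i\<bar> + \<bar>(P *\<^sub>v \<Delta>) $ i\<bar>)"
      using eps alpha R by (intro mult_left_mono) auto
    also have "\<dots> \<le> w $ i + \<epsilon> * \<alpha> / R * \<bar>(P *\<^sub>v \<Delta>) $ i\<bar>"
      using inv i unfolding iterate_inv_def distrib_left by simp
    finally show ?thesis using flow_weight[OF flow i] by simp
  qed
  moreover have "w0 $ i \<le> w' $ i" if i: "i < m" for i
    using inv i flow_weight_ge[OF flow i] unfolding iterate_inv_def by force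
  ultimately show ?thesis
    using inv t x \<Delta> Ax flow_weight_carrier[OF flow] by (simp add: iterate_inv_def)
qed

lemma iterate_inv_width:
  assumes inv: "iterate_inv t k x w" and pos: "0 < potential f w"
    and argmin: "is_arg_min (en w) (feasible A b) \<Delta>"
    and wide: "\<not> linf_norm (P *\<^sub>v \<Delta>) \<le> R * \<tau>"
    and change: "width_change f w0 R \<epsilon> (wide_coords P R \<tau> \<Delta>) w w'"
  shows "iterate_inv t (Suc k) x w'"
proof -
  have w: "w \<in> carrier_vec m" and w_ge: "\<forall>i<m. w0 $ i \<le> w $ i"
    using inv by (auto simp: iterate_inv_def)
  note width = w argmin wide w_ge pos refl change
  have "0 < \<mu>" by (rule mu_pos_if_wide[OF w pos argmin wide])
  then show ?thesis
    using inv width_weight_ge[OF width] width_weight_carrier[OF width]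
    unfolding iterate_inv_def by (meson order_trans)
qed

lemma nondecr_inv_init: "nondecr_inv 0 0 w0"
  using en_ge[OF w0] by (simp add: nondecr_inv_def)

lemma nonincr_inv_init: "nonincr_inv 0 0 w0"
  using en_xs[OF w0] xs(1) by (auto simp: nonincr_inv_def)

lemma nondecr_inv_pos: "nondecr_inv t k w \<Longrightarrow> 0 < potential f w"
  using potential_w0 by (simp add: nondecr_inv_def)

lemma nonincr_inv_pos: "nonincr_inv t k w \<Longrightarrow> 0 < potential f w"
  using potential_w0 mult_pos_pos[OF potential_w0 exp_gt_zero]
  unfolding nonincr_inv_def by (meson less_le_trans)

lemma nondecr_inv_flow:
  assumes nondecr: "nondecr_beyond w0 (d2 f)"
    and inv: "nondecr_inv t k w" "iterate_inv t k x w"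
    and argmin: "is_arg_min (en w) (feasible A b) \<Delta>"
    and narrow: "linf_norm (P *\<^sub>v \<Delta>) \<le> R * \<tau>"
    and w': "w' = w + (\<epsilon> * \<alpha> / R) \<cdot>\<^sub>v abs_vec (P *\<^sub>v \<Delta>)"
  shows "nondecr_inv (Suc t) k w'"
proof -
  have w: "w \<in> carrier_vec m" and w_ge: "\<And>i. i < m \<Longrightarrow> w0 $ i \<le> w $ i"
    using inv by (auto simp: iterate_inv_def)
  note flow = w argmin narrow w'
  have mono: "potential f w \<le> potential f w'" "\<And>i. i < m \<Longrightarrow> \<rho> w i \<le> \<rho> w' i"
    using nondecr_potential_\<rho>_mono[OF w flow_weight_carrier[OF flow] _ _ nondecr]
      w_ge flow_weight_ge[OF flow] by blast+
  have "potential f w' \<le> potential f w * exp flow_rate" by (rule flow_potential_le[OF flow])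
  also have "\<dots> \<le> potential f w0 * exp (real t * flow_rate + real k * width_rate) * exp flow_rate"
    using inv by (intro mult_right_mono) (auto simp: nondecr_inv_def)
  also have "\<dots> = potential f w0 * exp (real (Suc t) * flow_rate + real k * width_rate)"
    by (simp add: exp_add[symmetric] algebra_simps)
  finally show ?thesis
    using inv mono(1) order_trans[OF _ en_mono[OF mono(2)]] by (simp add: nondecr_inv_def)
qed

lemma nondecr_inv_width:
  assumes nondecr: "nondecr_beyond w0 (d2 f)"
    and inv: "nondecr_inv t k w" "iterate_inv t k x w"
    and argmin: "is_arg_min (en w) (feasible A b) \<Delta>"
    and wide: "\<not> linf_norm (P *\<^sub>v \<Delta>) \<le> R * \<tau>"
    and change: "width_change f w0 R \<epsilon> (wide_coords P R \<tau> \<Delta>) w w'"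
  shows "nondecr_inv t (Suc k) w'"
proof -
  have w: "w \<in> carrier_vec m" and w_ge: "\<forall>i<m. w0 $ i \<le> w $ i"
    using inv by (auto simp: iterate_inv_def)
  note width = w argmin wide w_ge nondecr_inv_pos[OF inv(1)] refl change nondecr
  have "potential f w' \<le> potential f w * exp width_rate" by (rule width_potential_le[OF width])
  also have "\<dots> \<le> potential f w0 * exp (real t * flow_rate + real k * width_rate) * exp width_rate"
    using inv by (intro mult_right_mono) (auto simp: nondecr_inv_def)
  also have "\<dots> = potential f w0 * exp (real t * flow_rate + real (Suc k) * width_rate)"
    by (simp add: exp_add[symmetric] algebra_simps)
  finally have pot: "potential f w' \<le> \<dots>" .
  define E0 where "E0 = \<epsilon> * potential f w0 * \<mu> / (real m * R\<^sup>2)"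
  have "E0 * exp (real (Suc k) * energy_rate) \<le> en w' y" if y: "feasible A b y" for y
  proof -
    have "E0 * exp (real (Suc k) * energy_rate) = E0 * exp (real k * energy_rate) * exp energy_rate"
      by (simp add: exp_add[symmetric] algebra_simps)
    also have "\<dots> \<le> en w \<Delta> * exp energy_rate"
      using inv argmin by (intro mult_right_mono) (auto simp: nondecr_inv_def is_arg_min_linorder E0_def)
    also have "\<dots> \<le> en w' y" by (rule width_energy_ge[OF width y])
    finally show ?thesis .
  qed
  moreover have "potential f w0 \<le> potential f w'"
    using width_potential_mono[OF width] inv(1) by (simp add: nondecr_inv_def)
  ultimately show ?thesis using pot by (simp add: nondecr_inv_def E0_def)
qed

lemma nonincr_inv_flow:
  assumes nonincr: "nonincr_beyond w0 (d2 f)"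
    and inv: "nonincr_inv t k w" "iterate_inv t k x w"
    and argmin: "is_arg_min (en w) (feasible A b) \<Delta>"
    and narrow: "linf_norm (P *\<^sub>v \<Delta>) \<le> R * \<tau>"
    and w': "w' = w + (\<epsilon> * \<alpha> / R) \<cdot>\<^sub>v abs_vec (P *\<^sub>v \<Delta>)"
  shows "nonincr_inv (Suc t) k w'"
proof -
  have w: "w \<in> carrier_vec m" and w_ge: "\<And>i. i < m \<Longrightarrow> w0 $ i \<le> w $ i"
    using inv by (auto simp: iterate_inv_def)
  note flow = w argmin narrow w'
  have mono: "\<And>i. i < m \<Longrightarrow> \<rho> w' i \<le> \<rho> w i"
    using nonincr_potential_\<rho>_antimono[OF w flow_weight_carrier[OF flow] _ _ nonincr]
      w_ge flow_weight_ge[OF flow] by blast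
  have "potential f w0 * exp (- (real (Suc t) * flow_rate + real k * width_rate))
      = potential f w0 * exp (- (real t * flow_rate + real k * width_rate)) * exp (- flow_rate)"
    by (simp add: exp_add[symmetric] algebra_simps)
  also have "\<dots> \<le> potential f w * exp (- flow_rate)"
    using inv by (intro mult_right_mono) (auto simp: nonincr_inv_def)
  also have "\<dots> \<le> potential f w'" by (rule flow_potential_ge[OF flow])
  finally show ?thesis
    using inv order_trans[OF en_mono[OF mono]] unfolding nonincr_inv_def by blast
qed

lemma nonincr_inv_width:
  assumes nonincr: "nonincr_beyond w0 (d2 f)"
    and inv: "nonincr_inv t k w" "iterate_inv t k x w"
    and argmin: "is_arg_min (en w) (feasible A b) \<Delta>"
    and wide: "\<not> linf_norm (P *\<^sub>v \<Delta>) \<le> R * \<tau>"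
    and change: "width_change f w0 R \<epsilon> (wide_coords P R \<tau> \<Delta>) w w'"
  shows "nonincr_inv t (Suc k) w'"
proof -
  have w: "w \<in> carrier_vec m" and w_ge: "\<forall>i<m. w0 $ i \<le> w $ i"
    using inv by (auto simp: iterate_inv_def)
  note width = w argmin wide w_ge nonincr_inv_pos[OF inv(1)] refl change nonincr
  have "potential f w0 * exp (- (real t * flow_rate + real (Suc k) * width_rate))
      = potential f w0 * exp (- (real t * flow_rate + real k * width_rate)) * exp (- width_rate)"
    by (simp add: exp_add[symmetric] algebra_simps)
  also have "\<dots> \<le> potential f w * exp (- width_rate)"
    using inv by (intro mult_right_mono) (auto simp: nonincr_inv_def)
  also have "\<dots> \<le> potential f w'" by (rule width_potential_ge[OF width])
  finally have pot: "potential f w0 * exp (- (real t * flow_rate + real (Suc k) * width_rate))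
      \<le> potential f w'" .
  obtain y where y: "feasible A b y"
    "en w y \<le> (1 + \<epsilon>) * potential f w0 * exp (- (real k * energy_rate))"
    using inv(1) unfolding nonincr_inv_def by blast
  have "en w' \<Delta> \<le> en w \<Delta> * exp (- energy_rate)" by (rule width_energy_le[OF width])
  also have "\<dots> \<le> en w y * exp (- energy_rate)"
    using argmin y(1) by (intro mult_right_mono) (auto simp: is_arg_min_linorder)
  also have "\<dots> \<le> (1 + \<epsilon>) * potential f w0 * exp (- (real k * energy_rate)) * exp (- energy_rate)"
    using y(2) by (rule mult_right_mono) simp
  also have "\<dots> = (1 + \<epsilon>) * potential f w0 * exp (- (real (Suc k) * energy_rate))"
    by (simp add: exp_add[symmetric] algebra_simps)
  finally show ?thesis
    using pot argmin unfolding nonincr_inv_def is_arg_min_linorder by blast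
qed

text \<open>\<open>iterate_inv\<close> travels together with a potential bound, because its width
  reduction case needs a positive potential, which comes from the monotone case at hand. Both
  implications are kept, as a constant \<open>f''\<close> falls under both.\<close>

lemma reachable_inv:
  assumes "reachable s"
  shows "case s of (t, k, x, w) \<Rightarrow>
    (nondecr_beyond w0 (d2 f) \<longrightarrow> iterate_inv t k x w \<and> nondecr_inv t k w) \<and>
    (nonincr_beyond w0 (d2 f) \<longrightarrow> iterate_inv t k x w \<and> nonincr_inv t k w)"
  using assms unfolding mwu_reachable_def
proof (induction rule: rtranclp_induct)
  case base
  then show ?case
    using iterate_inv_init nondecr_inv_init nonincr_inv_init by simp
next
  case (step s s')
  from step.hyps(2) step.IH show ?case
  proof (cases rule: mwu_step.cases)
    case (flow t w \<Delta> k x)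
    then show ?thesis
      using step.IH iterate_inv_flow[OF _ flow(3,4,5) refl]
        nondecr_inv_flow[OF _ _ _ flow(4,5) refl] nonincr_inv_flow[OF _ _ _ flow(4,5) refl]
      by simp blast
  next
    case (width_reduction t w \<Delta> w' k x)
    then show ?thesis
      using step.IH iterate_inv_width[OF _ _ width_reduction(4,5,6)]
        nondecr_inv_width[OF _ _ _ width_reduction(4,5,6)]
        nonincr_inv_width[OF _ _ _ width_reduction(4,5,6)]
        nondecr_inv_pos[of t k w] nonincr_inv_pos[of t k w]
      by simp blast
  qed
qed

section \<open>Counting width reductions\<close>

lemma flow_rate_total: "t \<le> T \<Longrightarrow> real t * flow_rate \<le> 1 + 3 * \<epsilon>"
proof -
  assume "t \<le> T"
  then have "real t * flow_rate \<le> real T * flow_rate"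
    using eps by (intro mult_right_mono) (auto simp: flow_rate_def)
  then show ?thesis using T by (simp add: flow_rate_def)
qed

text \<open>Both monotone cases lead to the inequality \<open>le\<close>. After taking logarithms,
  the left side grows by \<open>2 * \<Lambda> / \<tau>\<close> per width reduction. On the right,
  \<open>\<Lambda>\<close> covers \<open>ln Q\<close> and the flow steps, and
  \<open>\<Lambda> / \<tau>\<close> per width reduction covers \<open>\<epsilon> / \<tau>\<close>;
  what is left over is \<open>real k * (\<Lambda> / \<tau>) \<le> \<Lambda>\<close>.\<close>

lemma width_steps_le:
  assumes inv: "iterate_inv t k x w" and k: "0 < k"
    and le: "\<epsilon> * potential f w0 * \<mu> / (real m * R\<^sup>2) * exp (real k * energy_rate)
      \<le> (1 + \<epsilon>) * potential f w0 * exp (real t * flow_rate + real k * width_rate)"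
  shows "real k \<le> \<tau>"
proof -
  define Q where "Q = (1 + \<epsilon>) * real m * R\<^sup>2 / (\<epsilon> * \<mu>)"
  have mu: "0 < \<mu>" and t: "t \<le> T" using inv k by (auto simp: iterate_inv_def)
  have Q: "0 < Q" using mu eps R m_pos by (simp add: Q_def)
  define c where "c = \<epsilon> * potential f w0 * \<mu> / (real m * R\<^sup>2)"
  have c: "0 < c" using eps mu R m_pos potential_w0 by (simp add: c_def)
  have cQ: "(1 + \<epsilon>) * potential f w0 = c * Q"
    using eps mu R m_pos by (simp add: c_def Q_def)
  have "c * exp (real k * energy_rate) \<le> c * (Q * exp (real t * flow_rate + real k * width_rate))"
    using le unfolding cQ c_def[symmetric] by (simp add: mult.assoc)
  then have "exp (real k * energy_rate) \<le> Q * exp (real t * flow_rate + real k * width_rate)"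
    using c by simp
  also have "\<dots> = exp (ln Q + real t * flow_rate + real k * width_rate)"
    using Q by (simp add: exp_add)
  finally have "real k * energy_rate \<le> ln Q + real t * flow_rate + real k * width_rate" by simp
  moreover note flow_rate_total[OF t]
  moreover have "real k * width_rate \<le> real k * (\<Lambda> / \<tau>)"
    unfolding width_rate_def using Lam(1) eps tau_pos
    by (intro mult_left_mono divide_right_mono) auto
  ultimately have "real k * energy_rate \<le> \<Lambda> + real k * (\<Lambda> / \<tau>)"
    using Lam(2)[OF mu] by (simp add: Q_def)
  moreover have "real k * energy_rate = real k * (\<Lambda> / \<tau>) + real k * (\<Lambda> / \<tau>)"
    by (simp add: energy_rate_def)
  ultimately have "real k * (\<Lambda> / \<tau>) \<le> \<Lambda>" by linarith
  then have "\<Lambda> * real k \<le> \<Lambda> * \<tau>" using tau_pos by (simp add: field_simps)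
  then show ?thesis using Lam(1) eps by simp
qed

lemma nondecr_width_steps_le:
  assumes "iterate_inv t k x w" "nondecr_inv t k w"
  shows "real k \<le> \<tau>"
proof (cases "0 < k")
  case True
  have w: "w \<in> carrier_vec m" using assms by (simp add: iterate_inv_def)
  have "\<epsilon> * potential f w0 * \<mu> / (real m * R\<^sup>2) * exp (real k * energy_rate) \<le> en w xs"
    using assms(2) xs(1) unfolding nondecr_inv_def by blast
  also have "\<dots> \<le> (1 + \<epsilon>) * potential f w" by (rule en_xs[OF w])
  also have "\<dots> \<le> (1 + \<epsilon>) * (potential f w0 * exp (real t * flow_rate + real k * width_rate))"
    using assms(2) eps by (intro mult_left_mono) (auto simp: nondecr_inv_def)
  finally show ?thesis
    by (intro width_steps_le[OF assms(1) True]) (simp add: mult.assoc)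
qed (use tau_pos in simp)

lemma nonincr_width_steps_le:
  assumes "iterate_inv t k x w" "nonincr_inv t k w"
  shows "real k \<le> \<tau>"
proof (cases "0 < k")
  case True
  have w: "w \<in> carrier_vec m" using assms by (simp add: iterate_inv_def)
  define u where "u = real t * flow_rate + real k * width_rate"
  define c where "c = \<epsilon> * \<mu> / (real m * R\<^sup>2)"
  have c: "0 \<le> c" using eps mu_nonneg by (simp add: c_def)
  obtain y where y: "feasible A b y"
    "en w y \<le> (1 + \<epsilon>) * potential f w0 * exp (- (real k * energy_rate))"
    using assms(2) unfolding nonincr_inv_def by blast
  have "c * (potential f w0 * exp (- u)) \<le> c * potential f w"
    using assms(2) c unfolding u_def by (intro mult_left_mono) (auto simp: nonincr_inv_def)
  also have "\<dots> \<le> en w y" using en_ge[OF w y(1)] by (simp add: c_def mult_ac)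
  also note y(2)
  \<comment> \<open>Multiplying away the two decaying exponentials gives the inequality of the
    non-decreasing case.\<close>
  finally have "c * (potential f w0 * exp (- u)) * exp (real k * energy_rate + u)
      \<le> (1 + \<epsilon>) * potential f w0 * exp (- (real k * energy_rate)) * exp (real k * energy_rate + u)"
    by (rule mult_right_mono) simp
  then have "c * potential f w0 * exp (real k * energy_rate) \<le> (1 + \<epsilon>) * potential f w0 * exp u"
    by (simp add: mult.assoc exp_add[symmetric])
  then show ?thesis
    by (intro width_steps_le[OF assms(1) True]) (simp add: c_def u_def mult_ac)
qed (use tau_pos in simp)

lemma total_rate_le:
  assumes "t \<le> T" "real k \<le> \<tau>"
  shows "real t * flow_rate + real k * width_rate \<le> 1 + 4 * \<epsilon>"
proof -
  note flow_rate_total[OF assms(1)]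
  moreover have "real k * width_rate \<le> \<epsilon>"
    using assms tau_pos eps by (simp add: width_rate_def field_simps)
  ultimately show ?thesis by simp
qed

section \<open>Step bounds, termination and output of a run\<close>

context
  assumes monotone: "nondecr_beyond w0 (d2 f) \<or> nonincr_beyond w0 (d2 f)"
begin

lemma reachable_iterate_inv: "reachable (t, k, x, w) \<Longrightarrow> iterate_inv t k x w"
  using reachable_inv[of "(t, k, x, w)"] monotone by auto

lemma reachable_potential_pos: "reachable (t, k, x, w) \<Longrightarrow> 0 < potential f w"
  using reachable_inv[of "(t, k, x, w)"] monotone nondecr_inv_pos nonincr_inv_pos by auto

lemma reachable_steps_le:
  assumes "reachable (t, k, x, w)"
  shows "t \<le> T" and "real k \<le> \<tau>"
proof -
  have "iterate_inv t k x w" by (rule reachable_iterate_inv[OF assms])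
  then show "t \<le> T" "real k \<le> \<tau>"
    using reachable_inv[OF assms] monotone nondecr_width_steps_le[of t k x w]
      nonincr_width_steps_le[of t k x w]
    by (auto simp: iterate_inv_def)
qed

text \<open>A step is always possible before time \<open>T\<close>: the potential stays positive, so
  a minimizer exists, and the width change is realizable by assumption. The bounds on both counters
  leave room for finitely many steps.\<close>

lemma reachable_terminates:
  assumes realizable: "width_changes_realizable A b P f w0 R \<epsilon> \<tau> \<alpha> T"
    and "reachable s"
  shows "\<exists>K x w. step\<^sup>*\<^sup>* s (T, K, x, w)"
  using assms(2)
proof (induction "T + nat \<lfloor>\<tau>\<rfloor> - (fst s + fst (snd s))" arbitrary: s rule: less_induct)
  case less
  obtain t k x w where s: "s = (t, k, x, w)" by (cases s)
  have reach: "reachable (t, k, x, w)" using less.prems s by simp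
  show ?case
  proof (cases "t = T")
    case True
    then show ?thesis using s by blast
  next
    case False
    then have t: "t < T" using reachable_steps_le(1)[OF reach] by simp
    obtain \<Delta> where \<Delta>: "is_arg_min (en w) (feasible A b) \<Delta>"
      using argmin_exists reachable_potential_pos[OF reach] reachable_iterate_inv[OF reach]
      by (auto simp: iterate_inv_def)
    have "\<exists>s'. step s s' \<and> fst s' + fst (snd s') = Suc (t + k)"
    proof (cases "linf_norm (P *\<^sub>v \<Delta>) \<le> R * \<tau>")
      case True
      show ?thesis unfolding s
        by (rule exI, rule conjI, rule mwu_step.flow[OF t \<Delta> True]) simp
    next
      case False
      then obtain w' where "width_change f w0 R \<epsilon> (wide_coords P R \<tau> \<Delta>) w w'"
        using realizable reach t \<Delta> unfolding width_changes_realizable_def by blast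
      then show ?thesis unfolding s
        by (intro exI[of _ "(t, Suc k, x, w')"] conjI mwu_step.width_reduction[OF t \<Delta> False])
          simp_all
    qed
    then obtain s' where s': "step s s'" "fst s' + fst (snd s') = Suc (t + k)" by blast
    have reach': "reachable s'"
      using less.prems s'(1) unfolding mwu_reachable_def by (rule rtranclp.rtrancl_into_rtrancl)
    obtain t' k' x' w' where s'_eq: "s' = (t', k', x', w')" by (cases s')
    \<comment> \<open>Subtraction on \<open>nat\<close> truncates, so the strict decrease of the
      measure requires the successor state to respect the bounds as well.\<close>
    have "t' \<le> T" "k' \<le> nat \<lfloor>\<tau>\<rfloor>"
      using reachable_steps_le[of t' k' x' w'] reach' by (auto simp: s'_eq le_nat_floor)
    then have "T + nat \<lfloor>\<tau>\<rfloor> - (fst s' + fst (snd s')) < T + nat \<lfloor>\<tau>\<rfloor> - (fst s + fst (snd s))"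
      using s'(2) by (simp add: s s'_eq)
    then obtain K x w where "step\<^sup>*\<^sup>* s' (T, K, x, w)" using less.hyps reach' by blast
    then show ?thesis using s'(1) by (meson converse_rtranclp_into_rtranclp)
  qed
qed

text \<open>The norm bound is the path length invariant at time \<open>T\<close>: there
  \<open>\<epsilon> * \<alpha> / R\<close> equals \<open>1 / (R * M * real T)\<close>, and the
  average divides by \<open>real T\<close>.\<close>

lemma reachable_output:
  assumes reach: "reachable (T, k, x, w)" and xt: "xt = (1 / real T) \<cdot>\<^sub>v x"
  shows "A *\<^sub>v xt = b" and "linf_norm (P *\<^sub>v xt) \<le> R * M * linf_norm w"
    and "nondecr_beyond w0 (d2 f) \<Longrightarrow> potential f w \<le> potential f w0 * exp (1 + 4 * \<epsilon>)"
    and "nonincr_beyond w0 (d2 f) \<Longrightarrow> potential f w0 * exp (- (1 + 4 * \<epsilon>)) \<le> potential f w"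
proof -
  have inv: "iterate_inv T k x w" by (rule reachable_iterate_inv[OF reach])
  then have x: "x \<in> carrier_vec n" "A *\<^sub>v x = real T \<cdot>\<^sub>v b" and w: "w \<in> carrier_vec m"
    by (auto simp: iterate_inv_def)
  have "A *\<^sub>v xt = (1 / real T) \<cdot>\<^sub>v (real T \<cdot>\<^sub>v b)"
    using x by (simp add: xt mult_mat_vec[OF A])
  also have "\<dots> = b" using T by (intro eq_vecI) simp_all
  finally show "A *\<^sub>v xt = b" .
  have nonneg: "0 \<le> linf_norm w" by (simp add: linf_norm_def)
  show "linf_norm (P *\<^sub>v xt) \<le> R * M * linf_norm w"
  proof (rule linf_norm_le)
    show "0 \<le> R * M * linf_norm w" using R M nonneg by simp
    fix i assume "i < dim_vec (P *\<^sub>v xt)"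
    then have i: "i < m" using P by simp
    have "P *\<^sub>v xt = (1 / real T) \<cdot>\<^sub>v (P *\<^sub>v x)" using x by (simp add: xt mult_mat_vec[OF P])
    then have eq: "\<bar>(P *\<^sub>v xt) $ i\<bar> = \<bar>(P *\<^sub>v x) $ i\<bar> / real T"
      using i P by (simp add: abs_mult del: index_mult_mat_vec)
    have "\<epsilon> * \<alpha> / R * \<bar>(P *\<^sub>v x) $ i\<bar> \<le> w $ i" using inv i by (simp add: iterate_inv_def)
    also have "\<dots> \<le> linf_norm w" using linf_norm_ge[of i w] w i by simp
    finally have "R * M * (\<epsilon> * \<alpha> / R * \<bar>(P *\<^sub>v x) $ i\<bar>) \<le> R * M * linf_norm w"
      using R M by (intro mult_left_mono) auto
    moreover have "R * M * (\<epsilon> * \<alpha> / R * \<bar>(P *\<^sub>v x) $ i\<bar>) = (\<alpha> * M * \<epsilon>) * \<bar>(P *\<^sub>v x) $ i\<bar>"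
      using R by simp
    moreover have "\<alpha> * M * \<epsilon> = 1 / real T" using alpha_T T by (simp add: field_simps)
    ultimately show "\<bar>(P *\<^sub>v xt) $ i\<bar> \<le> R * M * linf_norm w" using eq by simp
  qed
  have rate: "real T * flow_rate + real k * width_rate \<le> 1 + 4 * \<epsilon>"
    by (intro total_rate_le reachable_steps_le[OF reach])
  show "potential f w \<le> potential f w0 * exp (1 + 4 * \<epsilon>)" if "nondecr_beyond w0 (d2 f)"
  proof -
    have "potential f w \<le> potential f w0 * exp (real T * flow_rate + real k * width_rate)"
      using reachable_inv[OF reach] that by (simp add: nondecr_inv_def)
    also have "\<dots> \<le> potential f w0 * exp (1 + 4 * \<epsilon>)"
      using rate potential_w0 by (intro mult_left_mono) auto
    finally show ?thesis .
  qed
  show "potential f w0 * exp (- (1 + 4 * \<epsilon>)) \<le> potential f w" if "nonincr_beyond w0 (d2 f)"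
  proof -
    have "potential f w0 * exp (- (1 + 4 * \<epsilon>))
        \<le> potential f w0 * exp (- (real T * flow_rate + real k * width_rate))"
      using rate potential_w0 by (intro mult_left_mono) auto
    also have "\<dots> \<le> potential f w" using reachable_inv[OF reach] that by (simp add: nonincr_inv_def)
    finally show ?thesis .
  qed
qed

end

end

section \<open>Choice of the parameters\<close>

lemma neg_ln_stretch_le:
  assumes y: "feasible A b y" and b: "0 < l2_norm b" and stretch: "0 < smallest_stretch A b P"
  shows "0 < l2_norm (P *\<^sub>v y)"
    and "- ln (l2_norm (P *\<^sub>v y)) \<le> \<bar>ln (op_norm A)\<bar> + \<bar>ln (l2_norm b)\<bar> + \<bar>ln (smallest_stretch A b P)\<bar>"
proof -
  have yc: "y \<in> carrier_vec (dim_col A)" and Ay: "A *\<^sub>v y = b"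
    using y by (auto simp: feasible_def)
  have le: "l2_norm b \<le> op_norm A * l2_norm y"
    using l2_norm_mult_mat_vec_le[OF yc] Ay by simp
  then have pos: "0 < op_norm A * l2_norm y" using b by linarith
  then have y_pos: "0 < l2_norm y" and A_pos: "0 < op_norm A"
    using l2_norm_nonneg[of y] by (auto simp: zero_less_mult_iff)
  have "y \<noteq> 0\<^sub>v (dim_col A)"
    using y_pos l2_norm_eq_0_iff[of y] by auto
  then have "smallest_stretch A b P \<le> l2_norm (P *\<^sub>v y) / l2_norm y"
    by (rule smallest_stretch_le[OF y])
  then have "smallest_stretch A b P * l2_norm y \<le> l2_norm (P *\<^sub>v y)"
    using y_pos by (simp add: pos_le_divide_eq)
  moreover have "smallest_stretch A b P * (l2_norm b / op_norm A) \<le> smallest_stretch A b P * l2_norm y"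
    using le A_pos stretch by (intro mult_left_mono) (auto simp: divide_le_eq mult.commute)
  ultimately have low: "smallest_stretch A b P * (l2_norm b / op_norm A) \<le> l2_norm (P *\<^sub>v y)"
    by linarith
  have low_pos: "0 < smallest_stretch A b P * (l2_norm b / op_norm A)"
    using stretch b A_pos by simp
  show "0 < l2_norm (P *\<^sub>v y)" using low low_pos by linarith
  have "ln (smallest_stretch A b P * (l2_norm b / op_norm A)) \<le> ln (l2_norm (P *\<^sub>v y))"
    using low low_pos by (intro ln_mono) auto
  moreover have "ln (smallest_stretch A b P * (l2_norm b / op_norm A))
      = ln (smallest_stretch A b P) + (ln (l2_norm b) - ln (op_norm A))"
    using stretch b A_pos by (simp add: ln_mult_pos ln_div)
  ultimately show "- ln (l2_norm (P *\<^sub>v y))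
      \<le> \<bar>ln (op_norm A)\<bar> + \<bar>ln (l2_norm b)\<bar> + \<bar>ln (smallest_stretch A b P)\<bar>"
    by linarith
qed

lemma log_size_ge_1: "1 \<le> log_size m \<epsilon> A b P R"
  by (simp add: log_size_def)

text \<open>The squares of \<open>R\<close> and of the norm account for the factor 2, and
  \<open>ln (1 + \<epsilon>)\<close> is replaced by \<epsilon>. This term and the
  \<open>3 * \<epsilon>\<close> in \<open>\<Lambda>\<close> are not logarithmic in \<epsilon>, which
  is one reason why the constants depend on an upper bound for \<epsilon>.\<close>

lemma energy_ratio_log_le:
  assumes y: "feasible A b y" and b: "0 < l2_norm b" and stretch: "0 < smallest_stretch A b P"
    and "0 < \<epsilon>" "0 < m" "0 < R"
  shows "ln ((1 + \<epsilon>) * real m * R\<^sup>2 / (\<epsilon> * (l2_norm (P *\<^sub>v y))\<^sup>2))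
    \<le> \<epsilon> + 2 * (log_size m \<epsilon> A b P R - 1)"
proof -
  note pos = neg_ln_stretch_le(1)[OF y b stretch]
  have "ln ((1 + \<epsilon>) * real m * R\<^sup>2 / (\<epsilon> * (l2_norm (P *\<^sub>v y))\<^sup>2))
      = ln (1 + \<epsilon>) + ln (real m) + 2 * ln R + ln (1 / \<epsilon>) + 2 * (- ln (l2_norm (P *\<^sub>v y)))"
    using assms pos by (simp add: ln_div ln_mult_pos ln_realpow)
  moreover have "ln (1 + \<epsilon>) \<le> \<epsilon>" using assms by (intro ln_add_one_self_le_self) simp
  ultimately show ?thesis
    using neg_ln_stretch_le(2)[OF y b stretch] abs_ge_self[of "ln (real m)"]
      abs_ge_self[of "ln R"] abs_ge_self[of "ln (1 / \<epsilon>)"] abs_ge_zero[of "ln (real m)"]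
      abs_ge_zero[of "ln (1 / \<epsilon>)"]
    unfolding log_size_def by argo
qed

lemma powr_two_thirds_le: "0 < x \<Longrightarrow> x powr (2 / 3) \<le> 1 + x" for x :: real
proof (cases "x \<le> 1")
  case True
  moreover assume "0 < x"
  ultimately have "x powr (2 / 3) \<le> 1" by (intro powr_le1) auto
  then show ?thesis using \<open>0 < x\<close> by simp
next
  case False
  moreover assume "0 < x"
  ultimately have "x powr (2 / 3) \<le> x powr 1" by (intro powr_mono) auto
  then show ?thesis using \<open>0 < x\<close> by simp
qed

text \<open>The exponents in \<open>g\<close> are made for
  \<open>\<epsilon>\<^sup>2 * g ^ 3 = real m\<close>, which reduces the cube condition to a
  comparison of constant factors. When \<epsilon> exceeds 1, \<open>g\<close> may fall below 1; the
  factor \<open>1 + e\<close> in \<open>\<tau>\<close> compensates for that.\<close>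

lemma parameter_choice:
  fixes \<epsilon> e \<Lambda> :: real
  assumes "0 < \<epsilon>" "\<epsilon> \<le> e" "0 < m" "1 \<le> \<Lambda>"
    and g: "g = real m powr (1 / 3) * \<epsilon> powr (- 2 / 3)" and \<tau>: "\<tau> = 4 * (1 + e) * \<Lambda> * g"
    and T: "T = nat \<lceil>\<tau> * (1 + \<epsilon>) / \<epsilon>\<rceil>"
  shows "0 < g" "4 * \<Lambda> \<le> \<tau>" "4 * \<Lambda> * (1 + \<epsilon>)\<^sup>2 * real m \<le> \<epsilon>\<^sup>2 * \<tau> ^ 3"
    and "\<tau> * (1 + \<epsilon>) \<le> \<epsilon> * real T" "\<epsilon> * real T \<le> 2 * (1 + e) * \<tau>" "0 < T"
proof -
  show g_pos: "0 < g" using assms by simp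
  have "\<epsilon> powr (2 / 3) \<le> 1 + e" using powr_two_thirds_le[of \<epsilon>] assms by simp
  then have "1 \<le> (1 + e) * \<epsilon> powr (- 2 / 3)"
    using assms by (simp add: powr_minus field_simps)
  also have "\<dots> \<le> (1 + e) * g"
    using assms ge_one_powr_ge_zero[of "real m" "1 / 3"] by (simp add: g)
  finally have "4 * \<Lambda> * 1 \<le> 4 * \<Lambda> * ((1 + e) * g)" using assms by (intro mult_left_mono) auto
  then show tau_ge: "4 * \<Lambda> \<le> \<tau>" by (simp add: \<tau> mult_ac)
  have g3: "\<epsilon>\<^sup>2 * g ^ 3 = real m"
  proof -
    have "g ^ 3 = real m * \<epsilon> powr (- 2)"
      using assms by (simp add: g power_mult_distrib powr_power)
    then show ?thesis using assms by (simp add: powr_minus powr_numeral)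
  qed
  have "4 * \<Lambda> * (1 + \<epsilon>)\<^sup>2 * real m \<le> (4 ^ 3 * (1 + e)) * \<Lambda> ^ 3 * (1 + e)\<^sup>2 * real m"
    using assms self_le_power[of \<Lambda> 3] by (intro mult_right_mono mult_mono power_mono) auto
  also have "\<dots> = (4 * (1 + e) * \<Lambda>) ^ 3 * (\<epsilon>\<^sup>2 * g ^ 3)"
    unfolding g3 by (simp add: power_mult_distrib power2_eq_square power3_eq_cube algebra_simps)
  also have "\<dots> = \<epsilon>\<^sup>2 * \<tau> ^ 3" by (simp add: \<tau> power_mult_distrib)
  finally show "4 * \<Lambda> * (1 + \<epsilon>)\<^sup>2 * real m \<le> \<epsilon>\<^sup>2 * \<tau> ^ 3" .
  have T_ge: "\<tau> * (1 + \<epsilon>) / \<epsilon> \<le> real T" unfolding T by linarith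
  then show "\<tau> * (1 + \<epsilon>) \<le> \<epsilon> * real T" using assms(1) by (simp add: divide_le_eq mult.commute)
  have tau_pos: "0 < \<tau>" using tau_ge assms by linarith
  then have pos: "0 < \<tau> * (1 + \<epsilon>) / \<epsilon>" using assms by simp
  then show "0 < T" using T_ge by (cases T) auto
  have "real T \<le> \<tau> * (1 + \<epsilon>) / \<epsilon> + 1" using pos unfolding T by linarith
  then have "\<epsilon> * real T \<le> \<epsilon> * (\<tau> * (1 + \<epsilon>) / \<epsilon> + 1)"
    using assms(1) by (intro mult_left_mono) auto
  also have "\<dots> = \<tau> * (1 + \<epsilon>) + \<epsilon>" using assms(1) by (simp add: field_simps)
  \<comment> \<open>Rounding \<open>T\<close> up costs at most \<epsilon>, which is below
    \<open>\<tau> * (1 + \<epsilon>)\<close> because \<open>1 \<le> \<tau>\<close>; this is the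
    factor 2 in the bound.\<close>
  also have "\<dots> \<le> \<tau> * (1 + \<epsilon>) + \<tau> * (1 + \<epsilon>)"
    using mult_mono[of 1 \<tau> \<epsilon> "1 + \<epsilon>"] tau_ge assms(1,4) by simp
  also have "\<dots> \<le> 2 * (1 + e) * \<tau>"
    using mult_left_mono[of "1 + \<epsilon>" "1 + e" \<tau>] tau_pos assms(2) by (simp add: mult_ac)
  finally show "\<epsilon> * real T \<le> 2 * (1 + e) * \<tau>" by simp
qed

lemma soft_thetaI:
  assumes "0 < C" "1 \<le> L" "0 < g" "g \<le> C * L * v" "v \<le> C * L * g"
  shows "soft_theta C 1 L g v"
  using assms by (simp add: soft_theta_def divide_le_eq mult_ac)

text \<open>All three claims follow from the chain
  \<open>g \<le> \<tau> \<le> \<epsilon> * real T \<le> C * L * g\<close>, since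
  \<open>\<alpha> = 1 / (M * (\<epsilon> * real T))\<close>. The constant \<open>C\<close> collects
  \<open>4 * (1 + e)\<close> from \<open>\<tau>\<close>, \<open>2 * (1 + e)\<close> from
  \<open>T\<close> and \<open>D\<close> from \<open>\<Lambda>\<close>.\<close>

lemma soft_theta_parameters:
  fixes \<epsilon> e \<Lambda> :: real
  assumes "0 < \<epsilon>" "0 < e" "0 < M" "0 < m" "1 \<le> \<Lambda>" "1 \<le> L" "1 \<le> D" "\<Lambda> \<le> D * L"
    and g: "g = real m powr (1 / 3) * \<epsilon> powr (- 2 / 3)" and \<tau>: "\<tau> = 4 * (1 + e) * \<Lambda> * g"
    and T: "\<tau> * (1 + \<epsilon>) \<le> \<epsilon> * real T" "\<epsilon> * real T \<le> 2 * (1 + e) * \<tau>" "0 < T"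
    and \<alpha>: "\<alpha> = 1 / (real T * M * \<epsilon>)"
    and C: "C = 8 * (1 + e)\<^sup>2 * D"
  shows "soft_theta C 1 L (real m powr (1/3) * \<epsilon> powr (-2/3)) \<tau>"
    and "soft_theta C 1 L (real m powr (-1/3) * inverse M * \<epsilon> powr (2/3)) \<alpha>"
    and "soft_theta C 1 L (real m powr (1/3) * \<epsilon> powr (-5/3)) (real T)"
proof -
  have g_pos: "0 < g" using assms by simp
  have \<tau>_pos: "0 < \<tau>" using g_pos assms by simp
  have C_pos: "0 < C" using assms by simp
  have e1: "1 \<le> (1 + e)\<^sup>2" using assms by simp
  have "1 * 1 \<le> (1 + e)\<^sup>2 * D" using e1 assms by (intro mult_mono) auto
  then have "1 \<le> C" unfolding C by simp
  then have CL: "1 \<le> C * L" using mult_mono[of 1 C 1 L] assms by simp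
  have g_le: "g \<le> \<tau>"
  proof -
    have "1 * 1 \<le> (4 * (1 + e)) * \<Lambda>" using assms by (intro mult_mono) auto
    then show ?thesis using g_pos by (simp add: \<tau>)
  qed
  have upper: "2 * (1 + e) * \<tau> \<le> C * L * g"
  proof -
    have "8 * (1 + e)\<^sup>2 * g * \<Lambda> \<le> 8 * (1 + e)\<^sup>2 * g * (D * L)"
      using assms g_pos by (intro mult_left_mono) auto
    then show ?thesis by (simp add: \<tau> C power2_eq_square algebra_simps)
  qed
  have up: "\<tau> \<le> C * L * g"
    using upper \<tau>_pos assms by (smt (verit) mult_le_cancel_right1)
  have lower: "y \<le> C * L * x" if "y \<le> x" "0 < x" for x y :: real
    using that CL mult_right_mono[of 1 "C * L" x] by linarith
  show "soft_theta C 1 L (real m powr (1/3) * \<epsilon> powr (-2/3)) \<tau>"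
    unfolding g[symmetric]
    by (rule soft_thetaI[OF C_pos \<open>1 \<le> L\<close> g_pos lower[OF g_le \<tau>_pos] up])
  have T_ge: "\<tau> \<le> \<epsilon> * real T"
    using T \<tau>_pos assms by (smt (verit) mult_le_cancel_left1)
  have \<alpha>_eq: "\<alpha> = 1 / (M * (\<epsilon> * real T))" by (simp add: \<alpha> mult_ac)
  have h: "real m powr (-1/3) * inverse M * \<epsilon> powr (2/3) = 1 / (M * g)"
    using assms by (simp add: g powr_minus field_simps)
  show "soft_theta C 1 L (real m powr (-1/3) * inverse M * \<epsilon> powr (2/3)) \<alpha>"
    unfolding h
  proof (rule soft_thetaI[OF C_pos \<open>1 \<le> L\<close>])
    show "0 < 1 / (M * g)" using assms g_pos by simp
    have "1 / (M * g) \<le> C * L / (M * (\<epsilon> * real T))"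
      using upper T assms g_pos by (simp add: field_simps)
    then show "1 / (M * g) \<le> C * L * \<alpha>" by (simp add: \<alpha>_eq)
    have "\<alpha> \<le> 1 / (M * g)"
      unfolding \<alpha>_eq using T_ge g_le g_pos assms(1,3) T(3)
      by (intro divide_left_mono mult_left_mono mult_pos_pos) auto
    then show "\<alpha> \<le> C * L * (1 / (M * g))" using assms g_pos by (intro lower) auto
  qed
  have q: "real m powr (1/3) * \<epsilon> powr (-5/3) = g / \<epsilon>"
  proof -
    have "\<epsilon> powr (-5/3) = \<epsilon> powr (-2/3 - 1)" by simp
    also have "\<dots> = \<epsilon> powr (-2/3) / \<epsilon>" using assms by (subst powr_diff) simp
    finally show ?thesis by (simp add: g)
  qed
  show "soft_theta C 1 L (real m powr (1/3) * \<epsilon> powr (-5/3)) (real T)"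
    unfolding q
  proof (rule soft_thetaI[OF C_pos \<open>1 \<le> L\<close>])
    show "0 < g / \<epsilon>" using assms g_pos by simp
    have "g / \<epsilon> \<le> real T" using g_le T_ge assms(1) by (simp add: divide_le_eq mult.commute)
    then show "g / \<epsilon> \<le> C * L * real T" using T by (intro lower) auto
    have "\<epsilon> * real T \<le> C * L * g" using T upper by linarith
    then show "real T \<le> C * L * (g / \<epsilon>)" using assms(1) by (simp add: pos_le_divide_eq mult.commute)
  qed
qed

text \<open>The soft-Theta claims are made for positive stretch: for a vanishing one,
  \<open>ln 0 = 0\<close> would hide it from \<open>log_size\<close>. Since steps are
  nondeterministic, the counter bounds are stated for every reachable state, which excludes infinite
  runs, and termination says that no run gets stuck before time \<open>T\<close>.\<close>

theorem theorem3p3: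
  fixes eps_max :: real
  assumes "0 < eps_max"
  shows "\<exists>C>0. \<exists>p. \<forall>d n m A b P f M w0 xstar R \<epsilon>.
    qsc_setting d n m A b P f M w0 xstar R \<and> 0 < \<epsilon> \<and> \<epsilon> \<le> eps_max \<longrightarrow>
    (\<exists>\<tau>>0. \<exists>\<alpha>>0. \<exists>T>0.
       real T = 1 / (\<alpha> * M * \<epsilon>) \<and>
       (0 < smallest_stretch A b P \<longrightarrow>
          soft_theta C p (log_size m \<epsilon> A b P R)
            (real m powr (1/3) * \<epsilon> powr (-2/3)) \<tau> \<and>
          soft_theta C p (log_size m \<epsilon> A b P R)
            (real m powr (-1/3) * inverse M * \<epsilon> powr (2/3)) \<alpha> \<and>
          soft_theta C p (log_size m \<epsilon> A b P R)
            (real m powr (1/3) * \<epsilon> powr (-5/3)) (real T)) \<and>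
       (\<forall>t k x w. mwu_reachable A b P f w0 R \<epsilon> \<tau> \<alpha> T (t, k, x, w) \<longrightarrow>
          t \<le> T \<and> real k \<le> \<tau>) \<and>
       (width_changes_realizable A b P f w0 R \<epsilon> \<tau> \<alpha> T \<longrightarrow>
          (\<forall>s. mwu_reachable A b P f w0 R \<epsilon> \<tau> \<alpha> T s \<longrightarrow>
             (\<exists>K x w. (mwu_step A b P f w0 R \<epsilon> \<tau> \<alpha> T)\<^sup>*\<^sup>* s (T, K, x, w)))) \<and>
       (\<forall>K x w xt. mwu_reachable A b P f w0 R \<epsilon> \<tau> \<alpha> T (T, K, x, w) \<and>
          xt = (1 / real T) \<cdot>\<^sub>v x \<longrightarrow>
          A *\<^sub>v xt = b \<and>
          linf_norm (P *\<^sub>v xt) \<le> R * M * linf_norm w \<and>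
          (nondecr_beyond w0 (d2 f) \<longrightarrow>
             potential f w \<le> potential f w0 * exp (1 + 4 * \<epsilon>)) \<and>
          (nonincr_beyond w0 (d2 f) \<longrightarrow>
             potential f w \<ge> potential f w0 * exp (- (1 + 4 * \<epsilon>)))))"
proof -
  \<comment> \<open>Chosen so that \<open>1 + 4 * \<epsilon> + 2 * (L - 1) \<le> D * L\<close> for
    \<open>1 \<le> L\<close> and \<open>\<epsilon> \<le> eps_max\<close>.\<close>
  define D where "D = 2 + 4 * eps_max"
  define C where "C = 8 * (1 + eps_max)\<^sup>2 * D"
  have D: "1 \<le> D" using assms by (simp add: D_def)
  have C: "0 < C" using assms by (simp add: C_def D_def)
  show ?thesis
  proof (rule exI[of _ C], rule conjI[OF C], rule exI[of _ 1], intro allI impI, elim conjE, goal_cases)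
    case (1 d n m A b P f M w0 xstar R \<epsilon>)
    note setting = 1(1)[unfolded qsc_setting_def] and eps_bounds = 1(2,3)
    have A: "A \<in> carrier_mat d n" and P: "P \<in> carrier_mat m n"
      and xstar: "feasible A b xstar" and M: "0 < M" and R: "0 < R"
      and monotone: "nondecr_beyond w0 (d2 f) \<or> nonincr_beyond w0 (d2 f)"
      using setting by (auto simp: is_arg_min_linorder)
    have m: "0 < m"
      using setting by (cases m) (auto simp: potential_def)
    have P': "P \<in> carrier_mat m (dim_col A)" using A P by simp
    have sq: "energy P (vec m (\<lambda>_. 1)) y = (l2_norm (P *\<^sub>v y))\<^sup>2" for y
      using P by (simp add: energy_def power2_l2_norm)
    \<comment> \<open>With unit resistances the energy is the squared norm, so the existence result
      for minimizers also shows that \<mu> is attained.\<close>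
    obtain y0 where y0: "is_arg_min (energy P (vec m (\<lambda>_. 1))) (feasible A b) y0"
      using energy_argmin_exists[OF xstar P', of "vec m (\<lambda>_. 1)"] by auto
    define \<mu> where "\<mu> = (l2_norm (P *\<^sub>v y0))\<^sup>2"
    have y0_feasible: "feasible A b y0" and mu_le: "\<And>y. feasible A b y \<Longrightarrow> \<mu> \<le> (l2_norm (P *\<^sub>v y))\<^sup>2"
      using y0 by (auto simp: is_arg_min_linorder sq \<mu>_def)
    \<comment> \<open>For \<open>\<mu> = 0\<close> the logarithm is that of a division by zero, hence \<open>ln 0 = 0\<close>.\<close>
    define \<Lambda> where "\<Lambda> = 1 + 3 * \<epsilon> + max 0 (ln ((1 + \<epsilon>) * real m * R\<^sup>2 / (\<epsilon> * \<mu>)))"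
    define L where "L = log_size m \<epsilon> A b P R"
    have \<Lambda>: "1 \<le> \<Lambda>" using eps_bounds by (simp add: \<Lambda>_def)
    have L: "1 \<le> L" by (simp add: L_def log_size_ge_1)
    define g where "g = real m powr (1 / 3) * \<epsilon> powr (- 2 / 3)"
    define \<tau> where "\<tau> = 4 * (1 + eps_max) * \<Lambda> * g"
    define T where "T = nat \<lceil>\<tau> * (1 + \<epsilon>) / \<epsilon>\<rceil>"
    define \<alpha> where "\<alpha> = 1 / (real T * M * \<epsilon>)"
    note params = parameter_choice[OF eps_bounds m \<Lambda> g_def \<tau>_def T_def]
    have \<tau>: "0 < \<tau>" using params(2) \<Lambda> by linarith
    have \<alpha>: "0 < \<alpha>" using params(6) M eps_bounds by (simp add: \<alpha>_def)
    interpret qsc_mwu d n m A b P f M w0 xstar R \<epsilon> \<tau> \<alpha> T \<mu> \<Lambda>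
    proof
      show "\<alpha> * M * \<epsilon> * real T = 1" using params(6) M eps_bounds by (simp add: \<alpha>_def)
      show "\<exists>y. feasible A b y \<and> (\<Sum>i<m. ((P *\<^sub>v y) $ i)\<^sup>2) = \<mu>"
        using y0_feasible P by (auto simp: \<mu>_def power2_l2_norm)
      show "\<mu> \<le> (\<Sum>i<m. ((P *\<^sub>v y) $ i)\<^sup>2)" if "feasible A b y" for y
        using mu_le[OF that] P by (simp add: power2_l2_norm)
    qed (use setting eps_bounds params \<alpha> xstar in \<open>auto simp: \<mu>_def \<Lambda>_def\<close>)
    have \<Lambda>_le: "\<Lambda> \<le> D * L" if stretch: "0 < smallest_stretch A b P"
    proof -
      have "ln ((1 + \<epsilon>) * real m * R\<^sup>2 / (\<epsilon> * \<mu>)) \<le> \<epsilon> + 2 * (L - 1)"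
      proof (cases "\<mu> = 0")
        case True
        then show ?thesis using eps_bounds L by simp
      next
        case False
        \<comment> \<open>For \<open>b = 0\<close> the zero vector would be feasible and \<mu> would
          vanish.\<close>
        have "l2_norm b \<noteq> 0"
        proof
          assume "l2_norm b = 0"
          then have b0: "b = 0\<^sub>v d" using b_carrier by (simp add: l2_norm_eq_0_iff)
          have "A *\<^sub>v 0\<^sub>v n = 0\<^sub>v d" "P *\<^sub>v 0\<^sub>v n = 0\<^sub>v m"
            using A P by (auto simp: scalar_prod_def)
          moreover from this have "feasible A b (0\<^sub>v n)" unfolding feasible_carrier by (simp add: b0)
          moreover have "l2_norm (0\<^sub>v m) = 0" by (simp add: l2_norm_eq_0_iff)
          ultimately have "\<mu> \<le> 0" using mu_le[of "0\<^sub>v n"] by simp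
          then show False using False by (simp add: \<mu>_def)
        qed
        then have "0 < l2_norm b" using l2_norm_nonneg[of b] by simp
        then show ?thesis
          using energy_ratio_log_le[OF y0_feasible _ stretch eps_bounds(1) m R] by (simp add: L_def \<mu>_def)
      qed
      then have "\<Lambda> \<le> 1 + 4 * \<epsilon> + 2 * (L - 1)" using eps_bounds L by (simp add: \<Lambda>_def)
      also have "\<dots> \<le> 2 * L + 4 * eps_max * 1" using eps_bounds by simp
      also have "\<dots> \<le> D * L" using L assms by (simp add: D_def algebra_simps)
      finally show ?thesis .
    qed
    show ?case
    proof (rule exI[of _ \<tau>], rule conjI[OF \<tau>], rule exI[of _ \<alpha>], rule conjI[OF \<alpha>],
        rule exI[of _ T], rule conjI[OF params(6)], intro conjI allI impI)
      show "real T = 1 / (\<alpha> * M * \<epsilon>)" using M eps_bounds params(6) by (simp add: \<alpha>_def)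
    next
      assume "0 < smallest_stretch A b P"
      note theta = soft_theta_parameters[OF eps_bounds(1) assms M m \<Lambda> L D \<Lambda>_le[OF this] g_def \<tau>_def
          params(4,5,6) \<alpha>_def C_def, unfolded L_def]
      show "soft_theta C 1 (log_size m \<epsilon> A b P R) (real m powr (1/3) * \<epsilon> powr (-2/3)) \<tau>"
        "soft_theta C 1 (log_size m \<epsilon> A b P R) (real m powr (-1/3) * inverse M * \<epsilon> powr (2/3)) \<alpha>"
        "soft_theta C 1 (log_size m \<epsilon> A b P R) (real m powr (1/3) * \<epsilon> powr (-5/3)) (real T)"
        by (rule theta)+
    next
      fix t k x w
      assume "reachable (t, k, x, w)"
      then show "t \<le> T" "real k \<le> \<tau>" by (rule reachable_steps_le[OF monotone])+
    next
      fix s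
      assume "width_changes_realizable A b P f w0 R \<epsilon> \<tau> \<alpha> T" "reachable s"
      then show "\<exists>K x w. step\<^sup>*\<^sup>* s (T, K, x, w)" by (rule reachable_terminates[OF monotone])
    next
      fix K x w xt
      assume "reachable (T, K, x, w) \<and> xt = (1 / real T) \<cdot>\<^sub>v x"
      then have out: "reachable (T, K, x, w)" "xt = (1 / real T) \<cdot>\<^sub>v x" by auto
      note guarantees = reachable_output[OF monotone out]
      show "A *\<^sub>v xt = b" "linf_norm (P *\<^sub>v xt) \<le> R * M * linf_norm w"
        by (rule guarantees)+
      show "potential f w \<le> potential f w0 * exp (1 + 4 * \<epsilon>)" if "nondecr_beyond w0 (d2 f)"
        by (rule guarantees(3)[OF that])
      show "potential f w0 * exp (- (1 + 4 * \<epsilon>)) \<le> potential f w" if "nonincr_beyond w0 (d2 f)"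
        by (rule guarantees(4)[OF that])
    qed
  qed
qed

end
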